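(* Let $N(n)$ denote the number of symmetric chain decompositions of the Boolean lattice $2^{[n]}$. Then, as $n\to\infty$, $$N(n)=\left(\frac{n}{2e}+o(n)\right)^{2^n},$$ i.e. $N(n)^{1/2^n}=\frac{n}{2e}+o(n)$.
   Context: The Boolean lattice $2^{[n]}$ is the power set of $[n]=\{1,\dots,n\}$ ordered by inclusion. A chain $C_0\subset C_1\subset\dots\subset C_k$ in $2^{[n]}$ is symmetric if $|C_0|+|C_k|=n$ and $|C_i|=|C_0|+i$ for every $i\in[k]$ (a single set $C_0$ with $|C_0|=n/2$ is also a symmetric chain, with $k=0$). A symmetric chain decomposition is a partition of $2^{[n]}$ into symmetric chains. *)

theory Defs
  imports "HOL-Library.Disjoint_Sets" "HOL-Library.Landau_Symbols"
begin

text \<open>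
  A chain is identified with the set of its members, so that a decomposition is an (unordered)
  partition of the power set of \<open>{1..n}\<close>. The case \<open>k = 0\<close> gives a single set of size \<open>n / 2\<close>.
\<close>

definition symmetric_chain :: "nat \<Rightarrow> nat set set \<Rightarrow> bool" where
  "symmetric_chain n \<C> \<longleftrightarrow>
     (\<exists>(k::nat) (C :: nat \<Rightarrow> nat set).
        \<C> = C ` {0..k} \<and>
        (\<forall>i\<in>{0..k}. C i \<in> Pow {1..n}) \<and>
        (\<forall>i<k. C i \<subset> C (Suc i)) \<and>
        card (C 0) + card (C k) = n \<and>
        (\<forall>i\<in>{1..k}. card (C i) = card (C 0) + i))"

definition symmetric_chain_decomposition :: "nat \<Rightarrow> nat set set set \<Rightarrow> bool" where
  "symmetric_chain_decomposition n P \<longleftrightarrow>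
     partition_on (Pow {1..n}) P \<and> (\<forall>\<C>\<in>P. symmetric_chain n \<C>)"

definition num_scd :: "nat \<Rightarrow> nat" where
  "num_scd n = card {P. symmetric_chain_decomposition n P}"

end

theory Submission
  imports Defs "HOL-Analysis.Convex" "HOL-Computational_Algebra.Fundamental_Theorem_Algebra"
    "HOL-Real_Asymp.Real_Asymp"
begin

text \<open>
  Upper bound. A decomposition is determined by the injection sending each set below the middle to
  its successor and the one sending each set above the middle to its predecessor. Building such an
  injection greedily in a uniformly random order and applying Jensen's inequality gives a bound of
  Bregman type, about \<open>n / (2 * e)\<close> choices per set, because the numbers of candidates missed by the
  injection sum up to at most a middle binomial coefficient times \<open>(n + 1) / 2\<close>.

  Lower bound. Decompose the levels \<open>k..n - k\<close> for decreasing \<open>k\<close>. Passing from \<open>k + 1\<close> to \<open>k\<close> amounts to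
  choosing a perfect matching between \<open>level k \<union> level (n - k - 1)\<close> and \<open>level (k + 1) \<union> level (n - k)\<close>,
  in which the two ends of a chain that is not prolonged are matched with each other. This bipartite
  graph carries a doubly stochastic weighting, so the bound \<open>permanent \<ge> exp (- size)\<close> produces
  enough matchings. That bound is Gurvits' argument: the partially differentiated product of the
  row forms is stable, hence real-rooted along each new variable, and each differentiation
  decreases the capacity by a factor of at most \<open>e\<close>.
\<close>

section \<open>Permanents of doubly stochastic matrices\<close>

text \<open>Both bounds lose a factor \<open>e\<close> per set and gain a factor near
  \<open>n / 2\<close>: most sets lie on levels close to \<open>n / 2\<close>, hence have about
  \<open>n / 2\<close> neighbours on the next level, and a middle level is only a fraction of order
  \<open>1 / sqrt n\<close> of all sets. The upper bound counts the two halves independently,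
  forgetting that the ends of a chain lie on opposite levels. The lower bound cannot forget this:
  independent matchings of level \<open>k\<close> into level \<open>k + 1\<close> and of level
  \<open>n - k\<close> into level \<open>n - k - 1\<close> would prolong some chains at one end
  only. Admitting a whole chain as an edge between its two ends makes "both ends or neither" a
  consequence of having one perfect matching. The step at \<open>k\<close> has
  \<open>(n choose k) + (n choose (k + 1))\<close> vertices on each side; these sizes add up to at
  most \<open>2 ^ n\<close>, so all the steps together lose at most \<open>exp (2 ^ n)\<close>.
  Chain edges have weight at most 1, the edges at the two outer levels have weight
  \<open>1 / (n - k)\<close>; dividing the permanent by the largest possible product of weights
  produces the powers of \<open>n / 2\<close>.\<close>

definition bijs :: "'a set \<Rightarrow> 'b set \<Rightarrow> ('a \<Rightarrow> 'b) set" where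
  "bijs A B = {f \<in> A \<rightarrow>\<^sub>E B. bij_betw f A B}"

definition permanent :: "('a \<Rightarrow> 'b \<Rightarrow> real) \<Rightarrow> 'a set \<Rightarrow> 'b set \<Rightarrow> real" where
  "permanent w A B = (\<Sum>f\<in>bijs A B. \<Prod>a\<in>A. w a (f a))"

lemma finite_bijs [simp]: "finite A \<Longrightarrow> finite B \<Longrightarrow> finite (bijs A B)"
  unfolding bijs_def by (rule finite_subset[OF _ finite_PiE[of A "\<lambda>_. B"]]) auto

lemma bijs_empty: "bijs {} B = (if B = {} then {\<lambda>_. undefined} else {})"
  by (auto simp: bijs_def bij_betw_def)

lemma permanent_empty: "permanent w {} B = (if B = {} then 1 else 0)"
  by (simp add: permanent_def bijs_empty)

lemma permanent_eq_0: "finite A \<Longrightarrow> card A \<noteq> card B \<Longrightarrow> permanent w A B = 0"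
  unfolding permanent_def bijs_def by (rule sum.neutral) (auto dest: bij_betw_same_card)

lemma permanent_nonneg: "(\<And>a b. a \<in> A \<Longrightarrow> b \<in> B \<Longrightarrow> w a b \<ge> 0) \<Longrightarrow> permanent w A B \<ge> 0"
  unfolding permanent_def bijs_def by (intro sum_nonneg prod_nonneg) auto

text \<open>Expansion along row \<open>a\<close>: a bijection on \<open>insert a A\<close> is a
  value \<open>b\<close> together with a bijection from \<open>A\<close> onto
  \<open>B - {b}\<close>.\<close>

lemma permanent_insert:
  assumes "finite A" "finite B" "a \<notin> A"
  shows "permanent w (insert a A) B = (\<Sum>b\<in>B. w a b * permanent w A (B - {b}))"
proof -
  have "(\<Sum>b\<in>B. w a b * permanent w A (B - {b})) =
        (\<Sum>(b, g)\<in>(SIGMA b:B. bijs A (B - {b})). w a b * (\<Prod>x\<in>A. w x (g x)))"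
    using assms by (simp add: permanent_def sum_distrib_left sum.Sigma)
  also have "\<dots> = permanent w (insert a A) B"
    unfolding permanent_def
  proof (rule sum.reindex_bij_witness[where i = "\<lambda>f. (f a, f(a := undefined))" and j = "\<lambda>(b, g). g(a := b)"], goal_cases)
    case (1 p)
    then show ?case using assms by (auto simp: bijs_def PiE_def extensional_def fun_eq_iff)
  next
    case (2 p)
    then obtain b g where p: "p = (b, g)" "b \<in> B" "g \<in> bijs A (B - {b})" by auto
    have "bij_betw (g(a := b)) A (B - {b})"
      using p assms by (subst bij_betw_cong[of A _ g]) (auto simp: bijs_def)
    then have "bij_betw (g(a := b)) (insert a A) (insert b (B - {b}))"
      using assms by (auto simp: bij_betw_def inj_on_def)
    then have "bij_betw (g(a := b)) (insert a A) B" using p(2) by (simp add: insert_absorb)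
    then show ?case using p by (auto simp: bijs_def PiE_def extensional_def)
  next
    case (3 f)
    then show ?case by (auto simp: fun_eq_iff)
  next
    case (4 f)
    then have f: "bij_betw f (insert a A) B" "f \<in> insert a A \<rightarrow>\<^sub>E B" by (auto simp: bijs_def)
    have "bij_betw f A (B - {f a})"
      using f(1) assms(3) by (auto simp: bij_betw_def inj_on_def)
    then have "bij_betw (f(a := undefined)) A (B - {f a})"
      using assms by (subst bij_betw_cong[of A _ f]) auto
    then show ?case using f assms by (auto simp: bijs_def PiE_def extensional_def bij_betw_def)
  next
    case (5 p)
    then show ?case using assms by (auto simp: if_distrib intro!: prod.cong)
  qed
  finally show ?thesis by simp
qed

lemma permanent_pos:
  assumes "finite A" "finite B" "card A = card B" "\<And>a b. a \<in> A \<Longrightarrow> b \<in> B \<Longrightarrow> w a b > 0"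
  shows "permanent w A B > 0"
proof -
  obtain f where f: "bij_betw f A B" using assms finite_same_card_bij by blast
  have "restrict f A \<in> bijs A B" using f by (auto simp: bijs_def bij_betw_def inj_on_def)
  then have "bijs A B \<noteq> {}" by auto
  then show ?thesis unfolding permanent_def using assms
    by (intro sum_pos prod_pos) (auto simp: bijs_def intro: finite_bijs[unfolded bijs_def])
qed

text \<open>The coefficient of \<open>\<Prod>a\<in>T. x a\<close> in \<open>\<Prod>b\<in>B. (l b + (\<Sum>a\<in>T. x a * w a b))\<close>.\<close>

definition mixed :: "('a \<Rightarrow> 'b \<Rightarrow> real) \<Rightarrow> 'b set \<Rightarrow> 'a set \<Rightarrow> ('b \<Rightarrow> 'c::real_field) \<Rightarrow> 'c" where
  "mixed w B T l = (\<Sum>U\<in>Pow B. of_real (permanent w T (B - U)) * (\<Prod>b\<in>U. l b))"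

text \<open>The restriction of \<open>mixed\<close> to the line through \<open>l\<close> in
  direction \<open>v\<close>, kept as a polynomial so that its roots, degree and derivative can be
  used.\<close>

definition mixed_line ::
    "('a \<Rightarrow> 'b \<Rightarrow> real) \<Rightarrow> 'b set \<Rightarrow> 'a set \<Rightarrow> ('b \<Rightarrow> 'c::real_field) \<Rightarrow> ('b \<Rightarrow> 'c) \<Rightarrow> 'c poly" where
  "mixed_line w B T l v = (\<Sum>U\<in>Pow B. smult (of_real (permanent w T (B - U))) (\<Prod>b\<in>U. [:l b, v b:]))"

lemma poly_mixed_line: "poly (mixed_line w B T l v) t = mixed w B T (\<lambda>b. l b + t * v b)"
  by (simp add: mixed_line_def mixed_def poly_sum poly_prod mult.commute)

lemma mixed_of_real: "mixed w B T (\<lambda>b. of_real (x b)) = of_real (mixed w B T x)"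
  by (simp add: mixed_def)

lemma mixed_empty: "finite B \<Longrightarrow> mixed w B {} l = (\<Prod>b\<in>B. l b)"
proof -
  assume "finite B"
  have "mixed w B {} l = (\<Sum>U\<in>Pow B. if U = B then (\<Prod>b\<in>B. l b) else 0)"
    unfolding mixed_def by (rule sum.cong) (auto simp: permanent_empty)
  then show ?thesis using \<open>finite B\<close> by simp
qed

text \<open>Adding \<open>a\<close> to \<open>T\<close> introduces the variable \<open>x a\<close>,
  differentiates in it and sets it to 0. Differentiating the product drops one column
  \<open>b\<close> from \<open>U\<close>; collecting the terms with the same remaining set gives the
  expansion of a permanent along row \<open>a\<close>.\<close>

lemma pderiv_mixed_line:
  fixes l :: "'b \<Rightarrow> 'c::real_field"
  assumes "finite B" "finite T" "a \<notin> T"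
  shows "poly (pderiv (mixed_line w B T l (\<lambda>b. of_real (w a b)))) 0 = mixed w B (insert a T) l"
proof -
  let ?c = "\<lambda>U. of_real (permanent w T (B - U)) :: 'c"
  have fin: "finite U" if "U \<in> Pow B" for U using that assms(1) finite_subset by auto
  have "poly (pderiv (mixed_line w B T l (\<lambda>b. of_real (w a b)))) 0 =
      (\<Sum>U\<in>Pow B. \<Sum>b\<in>U. ?c U * (of_real (w a b) * (\<Prod>x\<in>U - {b}. l x)))"
    by (simp add: mixed_line_def higher_pderiv_sum[of 1, simplified] pderiv_smult poly_sum pderiv_prod poly_prod
         pderiv_pCons sum_distrib_left mult_ac)
  also have "\<dots> = (\<Sum>(U, b)\<in>(SIGMA U:Pow B. U). ?c U * (of_real (w a b) * (\<Prod>x\<in>U - {b}. l x)))"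
    using assms fin by (subst sum.Sigma) auto
  also have "\<dots> = (\<Sum>(U, b)\<in>(SIGMA U:Pow B. B - U).
      of_real (w a b * permanent w T (B - U - {b})) * (\<Prod>x\<in>U. l x))"
    by (rule sum.reindex_bij_witness[where i = "\<lambda>(U, b). (insert b U, b)" and j = "\<lambda>(U, b). (U - {b}, b)"])
       (auto simp: insert_absorb Diff_insert[symmetric] mult_ac simp flip: Diff_insert2)
  also have "\<dots> = (\<Sum>U\<in>Pow B. (\<Sum>b\<in>B - U. of_real (w a b * permanent w T (B - U - {b}))) * (\<Prod>x\<in>U. l x))"
    using assms by (subst sum.Sigma[symmetric]) (auto simp: sum_distrib_right)
  also have "\<dots> = mixed w B (insert a T) l"
    unfolding mixed_def using assms
    by (intro sum.cong refl) (simp add: permanent_insert)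
  finally show ?thesis .
qed

section \<open>Logarithmic derivatives of polynomials with roots in the left half-plane\<close>

lemma complex_poly_root_cases:
  fixes P :: "complex poly"
  obtains "degree P = 0" | r Q where "P = [:-r, 1:] * Q" "degree P = Suc (degree Q)" "P \<noteq> 0"
proof (cases "degree P = 0")
  case False
  then have "\<not> constant (poly P)" by (simp add: constant_degree)
  then obtain r where "poly P r = 0" using fundamental_theorem_of_algebra by blast
  then obtain Q where Q: "P = [:-r, 1:] * Q" by (auto simp: poly_eq_0_iff_dvd dvd_def)
  have "P \<noteq> 0" using False by auto
  then have "degree P = Suc (degree Q)" using Q by (subst Q, subst degree_mult_eq) auto
  with Q \<open>P \<noteq> 0\<close> that show ?thesis by blast
qed (use that in blast)

text \<open>The logarithmic derivative at 0 is the sum of \<open>- 1 / r\<close> over the roots, and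
  \<open>- 1 / r\<close> has positive real part when \<open>r\<close> has negative real part. As in
  the Gauss-Lucas theorem, the derivative of a nonconstant such polynomial therefore does not vanish
  at 0.\<close>

lemma Re_log_deriv_stable:
  fixes P :: "complex poly"
  assumes "P \<noteq> 0" "\<And>r. poly P r = 0 \<Longrightarrow> Re r < 0"
  shows "Re (poly (pderiv P) 0 / poly P 0) \<ge> 0 \<and>
         (degree P > 0 \<longrightarrow> Re (poly (pderiv P) 0 / poly P 0) > 0)"
  using assms
proof (induction "degree P" arbitrary: P rule: less_induct)
  case less
  show ?case
  proof (cases P rule: complex_poly_root_cases)
    case 1
    then obtain c where "P = [:c:]" by (metis degree_eq_zeroE)
    then show ?thesis by (simp add: pderiv_pCons)
  next
    case (2 r Q)
    have r: "Re r < 0" using less.prems 2 by auto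
    then have "r \<noteq> 0" by auto
    have Q: "Q \<noteq> 0" "\<And>s. poly Q s = 0 \<Longrightarrow> Re s < 0" using 2 less.prems by auto
    then have Q0: "poly Q 0 \<noteq> 0" by force
    have *: "Re (poly (pderiv Q) 0 / poly Q 0) \<ge> 0" using less.hyps[of Q] Q 2 by auto
    have "poly (pderiv P) 0 / poly P 0 = poly (pderiv Q) 0 / poly Q 0 + (- 1 / r)"
      using \<open>r \<noteq> 0\<close> Q0 unfolding 2(1) pderiv_mult by (simp add: pderiv_pCons field_simps)
    moreover have "Re (- 1 / r) > 0"
      using r \<open>r \<noteq> 0\<close> by (simp add: Re_divide complex_neq_0 divide_neg_pos sum_power2_gt_zero_iff complex_eq_iff)
    ultimately show ?thesis using * by (simp del: divide_minus_left)
  qed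
qed

text \<open>A negative real root \<open>s\<close> contributes the factor
  \<open>t - s = - s * (1 + t * (- 1 / s))\<close>, and \<open>1 + z \<le> exp z\<close>. The
  exponents add up to \<open>t\<close> times the logarithmic derivative at 0.\<close>

lemma norm_poly_le_exp:
  fixes P :: "complex poly"
  assumes "P \<noteq> 0" "\<And>r. poly P r = 0 \<Longrightarrow> r \<in> \<real> \<and> Re r < 0" "t \<ge> 0"
  shows "norm (poly P (of_real t)) \<le> norm (poly P 0) * exp (t * Re (poly (pderiv P) 0 / poly P 0))"
  using assms
proof (induction "degree P" arbitrary: P rule: less_induct)
  case less
  show ?case
  proof (cases P rule: complex_poly_root_cases)
    case 1
    then obtain c where "P = [:c:]" by (metis degree_eq_zeroE)
    then show ?thesis by (simp add: pderiv_pCons)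
  next
    case (2 r Q)
    obtain s where s: "r = of_real s" "s < 0" using less.prems(2)[of r] 2(1) by (auto elim!: Reals_cases)
    have Q: "Q \<noteq> 0" "\<And>s. poly Q s = 0 \<Longrightarrow> s \<in> \<real> \<and> Re s < 0" using 2 less.prems by auto
    then have Q0: "poly Q 0 \<noteq> 0" by force
    have *: "norm (poly Q (of_real t)) \<le> norm (poly Q 0) * exp (t * Re (poly (pderiv Q) 0 / poly Q 0))"
      using less.hyps[of Q] Q 2 less.prems by auto
    have eq: "poly (pderiv P) 0 / poly P 0 = poly (pderiv Q) 0 / poly Q 0 + of_real (- 1 / s)"
      using s Q0 unfolding 2(1) pderiv_mult by (simp add: pderiv_pCons field_simps)
    have "norm (of_real t - r) = t - s" using s less.prems(3)
      unfolding s(1) of_real_diff[symmetric] norm_of_real by simp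
    also have "\<dots> = - s * (1 + t * (- 1 / s))" using s by (simp add: field_simps)
    also have "\<dots> \<le> - s * exp (t * (- 1 / s))"
      using s exp_ge_add_one_self[of "t * (- 1 / s)"] by (intro mult_left_mono) auto
    finally have "norm (of_real t - r) \<le> - s * exp (t * (- 1 / s))" .
    then have "norm (of_real t - r) * norm (poly Q (of_real t)) \<le>
       (- s * exp (t * (- 1 / s))) * (norm (poly Q 0) * exp (t * Re (poly (pderiv Q) 0 / poly Q 0)))"
      using * s by (intro mult_mono) (auto simp: mult_nonpos_nonneg)
    also have "\<dots> = norm (poly P 0) * exp (t * Re (poly (pderiv P) 0 / poly P 0))"
      unfolding eq using s by (simp add: 2(1) norm_mult ring_distribs mult_exp_exp)
    also have "norm (of_real t - r) * norm (poly Q (of_real t)) = norm (poly P (of_real t))"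
      unfolding 2(1) poly_mult norm_mult by simp
    finally show ?thesis .
  qed
qed

text \<open>Only square blocks have a nonzero permanent, so all surviving terms of
  \<open>mixed\<close> have the same degree in \<open>l\<close>. Homogeneity and the top coefficient
  of \<open>mixed_line\<close> follow from this.\<close>

lemma card_Diff_perm:
  assumes "finite B" "finite T" "U \<subseteq> B" "permanent w T (B - U) \<noteq> 0"
  shows "card U + card T = card B"
proof -
  have "card T = card (B - U)" using permanent_eq_0 assms by metis
  also have "\<dots> = card B - card U" using assms by (meson card_Diff_subset finite_subset)
  finally show ?thesis using assms card_mono[of B U] by simp
qed

lemma mixed_scale:
  assumes "finite B" "finite T"
  shows "mixed w B T (\<lambda>b. u * l b) = u ^ (card B - card T) * mixed w B T l"
  unfolding mixed_def sum_distrib_left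
proof (rule sum.cong)
  fix U assume "U \<in> Pow B"
  then have "permanent w T (B - U) = 0 \<or> card U = card B - card T"
    using card_Diff_perm[OF assms, of U w] by force
  then show "of_real (permanent w T (B - U)) * (\<Prod>b\<in>U. u * l b) =
        u ^ (card B - card T) * (of_real (permanent w T (B - U)) * (\<Prod>b\<in>U. l b))"
    by (auto simp: prod.distrib)
qed simp

lemma mixed_pos:
  fixes v :: "'b \<Rightarrow> real"
  assumes "finite A" "finite B" "card A = card B" "\<And>a b. a \<in> A \<Longrightarrow> b \<in> B \<Longrightarrow> w a b > 0"
    and "T \<subseteq> A" "\<And>b. b \<in> B \<Longrightarrow> v b > 0"
  shows "mixed w B T v > 0"
proof -
  have T: "finite T" "card T \<le> card B" using assms finite_subset card_mono by metis+
  then obtain S where S: "S \<subseteq> B" "card S = card T" "finite S"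
    using obtain_subset_with_card_n[of "card T" B] by metis
  have "permanent w T (B - (B - S)) > 0"
    using S T assms by (intro permanent_pos) (auto simp: double_diff)
  then have "0 < permanent w T (B - (B - S)) * (\<Prod>b\<in>B - S. v b)"
    using assms by (intro mult_pos_pos prod_pos) auto
  moreover have "permanent w T (B - U) \<ge> 0" if "U \<in> Pow B" for U
    using assms(4,5) by (intro permanent_nonneg) (auto intro: less_imp_le)
  then have "of_real (permanent w T (B - U)) * (\<Prod>b\<in>U. v b) \<ge> 0" if "U \<in> Pow B" for U
    using that assms(6) by (auto intro!: mult_nonneg_nonneg prod_nonneg intro: less_imp_le)
  ultimately show ?thesis unfolding mixed_def
    using assms by (intro sum_pos2[where i = "B - S"]) auto
qed

lemma coeff_prod_linear:
  fixes v :: "'b \<Rightarrow> 'c::comm_ring_1"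
  assumes "finite U"
  shows "degree (\<Prod>b\<in>U. [:l b, v b:]) \<le> card U \<and> coeff (\<Prod>b\<in>U. [:l b, v b:]) (card U) = (\<Prod>b\<in>U. v b)"
  using assms
proof (induction rule: finite_induct)
  case (insert b U)
  let ?P = "\<Prod>b\<in>U. [:l b, v b:]"
  have "degree ([:l b, v b:] * ?P) \<le> Suc (card U)"
    by (rule order.trans[OF degree_mult_le]) (use insert.IH in auto)
  moreover have "coeff ?P (Suc (card U)) = 0" using insert.IH by (intro coeff_eq_0) auto
  ultimately show ?case using insert by (simp add: mult_pCons_left)
qed auto

lemma coeff_mixed_line:
  assumes "finite B" "finite T"
  shows "coeff (mixed_line w B T l v) (card B - card T) = mixed w B T v"
  unfolding mixed_line_def mixed_def coeff_sum
proof (rule sum.cong)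
  fix U assume U: "U \<in> Pow B"
  then have "permanent w T (B - U) = 0 \<or> card U = card B - card T"
    using card_Diff_perm[OF assms, of U w] by force
  then show "coeff (smult (of_real (permanent w T (B - U))) (\<Prod>b\<in>U. [:l b, v b:])) (card B - card T) =
         of_real (permanent w T (B - U)) * (\<Prod>b\<in>U. v b)"
    using coeff_prod_linear[of U l v] U assms finite_subset[of U B] by auto
qed simp

text \<open>Strict positivity makes the permanents of all nonempty square blocks positive, which
  gives \<open>mixed_line\<close> a positive degree. Matrices with zero entries are reached
  afterwards by a limit.\<close>

locale positive_matrix =
  fixes A :: "'a set" and B :: "'b set" and w :: "'a \<Rightarrow> 'b \<Rightarrow> real"
  assumes fin: "finite A" "finite B" and cards: "card A = card B"
    and pos: "\<And>a b. a \<in> A \<Longrightarrow> b \<in> B \<Longrightarrow> w a b > 0"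
begin

lemma mixed_line_degree:
  fixes l :: "'b \<Rightarrow> complex"
  assumes "T \<subseteq> A" "a \<in> A - T"
  shows "degree (mixed_line w B T l (\<lambda>b. of_real (w a b))) > 0"
proof -
  have "finite T" using assms fin finite_subset by auto
  have "T \<subset> A" using assms by auto
  then have lt: "card T < card B" using fin cards psubset_card_mono by metis
  have "mixed w B T (w a) > 0" using assms pos by (intro mixed_pos[OF fin cards pos]) auto
  then have "coeff (mixed_line w B T l (\<lambda>b. of_real (w a b))) (card B - card T) \<noteq> 0"
    using fin \<open>finite T\<close> by (simp add: coeff_mixed_line mixed_of_real)
  then have "card B - card T \<le> degree (mixed_line w B T l (\<lambda>b. of_real (w a b)))"
    by (rule le_degree)
  then show ?thesis using lt by linarith
qed

text \<open>Induction on \<open>T\<close>: if \<open>Re r \<ge> 0\<close>, then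
  \<open>l + r * w a\<close> stays in the right half-plane, so all roots of the line polynomial have
  negative real part. Its derivative at 0, which is the next \<open>mixed\<close>, is then nonzero
  by the bound on the logarithmic derivative.\<close>

lemma mixed_stable:
  fixes l :: "'b \<Rightarrow> complex"
  assumes "T \<subseteq> A" "\<And>b. b \<in> B \<Longrightarrow> Re (l b) > 0"
  shows "mixed w B T l \<noteq> 0"
proof -
  have "finite T" using assms fin finite_subset by auto
  then show ?thesis using assms
  proof (induction T arbitrary: l rule: finite_induct)
    case empty
    then show ?case using fin by (force simp: mixed_empty)
  next
    case (insert a T)
    let ?P = "mixed_line w B T l (\<lambda>b. of_real (w a b))"
    have deg: "degree ?P > 0" using insert by (intro mixed_line_degree) auto
    have "Re r < 0" if "poly ?P r = 0" for r
    proof (rule ccontr)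
      assume "\<not> Re r < 0"
      then have "mixed w B T (\<lambda>b. l b + r * of_real (w a b)) \<noteq> 0"
        using insert.prems pos by (intro insert.IH) (auto intro!: add_pos_nonneg simp: less_imp_le)
      then show False using that by (simp add: poly_mixed_line)
    qed
    moreover have "?P \<noteq> 0" using deg by auto
    ultimately have "Re (poly (pderiv ?P) 0 / poly ?P 0) > 0"
      using Re_log_deriv_stable[of ?P] deg by blast
    then have "poly (pderiv ?P) 0 \<noteq> 0" by auto
    then show ?case using insert fin by (simp add: pderiv_mixed_line)
  qed
qed

text \<open>Homogeneity and stability make \<open>t \<mapsto> mixed w B T (y + t * w a)\<close> real-rooted.\<close>

lemma mixed_line_real_rooted:
  assumes "T \<subseteq> A" "a \<in> A - T" "\<And>b. b \<in> B \<Longrightarrow> y b > 0"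
    and "poly (mixed_line w B T (\<lambda>b. complex_of_real (y b)) (\<lambda>b. of_real (w a b))) r = 0"
  shows "r \<in> \<real> \<and> Re r < 0"
proof (rule ccontr)
  assume nr: "\<not> (r \<in> \<real> \<and> Re r < 0)"
  \<comment> \<open>The factor \<open>u\<close> has to rotate both 1 and \<open>r\<close> into the
    right half-plane. The inverse square root sends them to \<open>1 / c\<close> and
    \<open>c\<close> with \<open>c * c = r\<close>, and \<open>Re c > 0\<close> unless
    \<open>r\<close> is real and at most 0; the root \<open>r = 0\<close> is handled by
    \<open>u = 1\<close>.\<close>
  define u where "u = (if r = 0 then 1 else inverse (csqrt r))"
  have "Re u > 0 \<and> Re (u * r) \<ge> 0"
  proof (cases "r = 0")
    case False
    define c where "c = csqrt r"
    have c: "c \<noteq> 0" "r = c * c" "Re c \<ge> 0" and u: "u = inverse c"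
      using False Re_csqrt[of r] power2_csqrt[of r, symmetric] csqrt_eq_0[of r]
      by (auto simp: c_def u_def power2_eq_square simp del: power2_csqrt csqrt.simps)
    have "Re c > 0"
    proof (rule ccontr)
      assume "\<not> ?thesis"
      then have "Re c = 0" using c by simp
      then have "r = - of_real ((Im c)\<^sup>2)" "Im c \<noteq> 0"
        using c by (auto simp: complex_eq_iff power2_eq_square)
      then show False using nr by simp
    qed
    then have "Re u > 0" using c by (simp add: u divide_pos_pos sum_power2_gt_zero_iff)
    moreover have "u * r = c" using c(1) by (simp add: u c(2))
    ultimately show ?thesis using c(3) by metis
  qed (simp add: u_def)
  moreover have "Re (u * (complex_of_real y' + r * of_real w')) = Re u * y' + Re (u * r) * w'" for y' w'
    by (simp add: algebra_simps)
  ultimately have "mixed w B T (\<lambda>b. u * (complex_of_real (y b) + r * of_real (w a b))) \<noteq> 0"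
    using assms(1-3) pos
    by (intro mixed_stable) (auto intro!: add_pos_nonneg mult_nonneg_nonneg mult_pos_pos
      simp del: times_complex.simps intro: less_imp_le)
  moreover have "finite T" using assms fin finite_subset by auto
  ultimately show False using assms(4) fin by (simp add: mixed_scale poly_mixed_line)
qed

text \<open>With \<open>R\<close> and \<open>D\<close> the value and the derivative of the line
  polynomial at 0, real-rootedness bounds its value at \<open>t\<close> by
  \<open>R * exp (t * D / R)\<close>. The choice \<open>t = R / D\<close> minimises
  \<open>exp (t * D / R) / t\<close> and gives \<open>C * R / D \<le> R * exp 1\<close>: this is the
  origin of the factor \<open>e\<close> per row.\<close>

lemma mixed_step:
  assumes T: "T \<subseteq> A" "a \<in> A - T" and y: "\<And>b. b \<in> B \<Longrightarrow> y b > (0::real)"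
    and C: "\<And>t. t > 0 \<Longrightarrow> mixed w B T (\<lambda>b. y b + t * w a b) \<ge> C * t"
  shows "mixed w B (insert a T) y \<ge> C * exp (- 1)"
proof -
  have finT: "finite T" using T fin finite_subset by auto
  define P where "P = mixed_line w B T (\<lambda>b. complex_of_real (y b)) (\<lambda>b. of_real (w a b))"
  define D where "D = mixed w B (insert a T) y"
  define R where "R = mixed w B T y"
  have D: "D > 0" and R: "R > 0"
    unfolding D_def R_def using T y by (auto intro!: mixed_pos[OF fin cards pos])
  have Pt: "poly P (of_real t) = of_real (mixed w B T (\<lambda>b. y b + t * w a b))" for t
    unfolding P_def poly_mixed_line mixed_of_real[symmetric] by simp
  have P0: "poly P 0 = of_real R" using Pt[of 0] by (simp add: R_def)
  have P': "poly (pderiv P) 0 = of_real D"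
    unfolding P_def D_def using fin finT T by (simp add: pderiv_mixed_line mixed_of_real)
  have "P \<noteq> 0" using P0 R by auto
  then have "norm (poly P (of_real (R / D))) \<le> norm (poly P 0) * exp (R / D * Re (poly (pderiv P) 0 / poly P 0))"
    using mixed_line_real_rooted[OF T y] D R by (intro norm_poly_le_exp) (auto simp: P_def)
  also have "R / D * Re (poly (pderiv P) 0 / poly P 0) = 1"
    unfolding P0 P' of_real_divide[symmetric] Re_complex_of_real using D R by simp
  finally have "mixed w B T (\<lambda>b. y b + R / D * w a b) \<le> R * exp 1"
    unfolding Pt P0 norm_of_real using R by linarith
  then have "C * (R / D) \<le> R * exp 1" using C[of "R / D"] D R by auto
  then have "C \<le> D * exp 1" using D R by (simp add: field_simps)
  then show ?thesis unfolding D_def[symmetric] by (simp add: exp_minus field_simps)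
qed

end

section \<open>Capacity and the permanent bound\<close>

lemma weighted_arith_geom_mean:
  fixes x w :: "'a \<Rightarrow> real"
  assumes "finite S" "(\<Sum>i\<in>S. w i) = 1" "\<And>i. i \<in> S \<Longrightarrow> w i \<ge> 0" "\<And>i. i \<in> S \<Longrightarrow> x i > 0"
  shows "(\<Prod>i\<in>S. x i powr w i) \<le> (\<Sum>i\<in>S. w i * x i)"
proof -
  have "S \<noteq> {}" using assms by auto
  have "(\<Prod>i\<in>S. x i powr w i) = exp (\<Sum>i\<in>S. w i *\<^sub>R ln (x i))"
    using assms by (force simp add: exp_sum powr_def intro!: prod.cong)
  also have "\<dots> \<le> (\<Sum>i\<in>S. w i * exp (ln (x i)))"
    using assms \<open>S \<noteq> {}\<close> by (intro convex_on_sum[OF _ _ exp_convex]) auto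
  also have "\<dots> = (\<Sum>i\<in>S. w i * x i)" using assms by (intro sum.cong) auto
  finally show ?thesis .
qed

text \<open>For empty \<open>T\<close> this is the weighted AM-GM inequality in each column, the
  column sums supplying the weights; the row sums make the exponents of each \<open>x a\<close> add
  up to 1. To move \<open>a\<close> into \<open>T\<close>, the induction hypothesis is applied with
  \<open>x a\<close> replaced by a free \<open>t\<close>, which is the linear lower bound required
  by \<open>mixed_step\<close>. Some row stays outside \<open>T\<close>, so the remaining forms are
  positive.\<close>

lemma (in positive_matrix) mixed_capacity:
  assumes "\<And>a. a \<in> A \<Longrightarrow> (\<Sum>b\<in>B. w a b) = 1" "\<And>b. b \<in> B \<Longrightarrow> (\<Sum>a\<in>A. w a b) = 1"
    and "T \<subset> A" "\<And>a. a \<in> A \<Longrightarrow> x a > 0"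
  shows "mixed w B T (\<lambda>b. \<Sum>a\<in>A - T. x a * w a b) \<ge> exp (- real (card T)) * (\<Prod>a\<in>A - T. x a)"
proof -
  have "finite T" using assms(3) fin finite_subset by blast
  then show ?thesis using assms(3,4)
  proof (induction T arbitrary: x rule: finite_induct)
    case empty
    have "(\<Prod>a\<in>A. x a) = (\<Prod>a\<in>A. x a powr (\<Sum>b\<in>B. w a b))"
      using empty assms(1) by (intro prod.cong) (auto simp: less_imp_le)
    also have "\<dots> = (\<Prod>b\<in>B. \<Prod>a\<in>A. x a powr w a b)"
      using empty fin by (subst prod.swap) (intro prod.cong refl powr_sum, fastforce+)
    also have "\<dots> \<le> (\<Prod>b\<in>B. \<Sum>a\<in>A. w a b * x a)"
      using empty fin assms(2) pos
      by (intro prod_mono conjI prod_nonneg weighted_arith_geom_mean) (auto intro: less_imp_le)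
    finally show ?case using fin by (simp add: mixed_empty mult.commute)
  next
    case (insert a T)
    let ?y = "\<lambda>b. \<Sum>a\<in>A - insert a T. x a * w a b"
    let ?C = "exp (- real (card T)) * (\<Prod>a\<in>A - insert a T. x a)"
    have split: "A - T = insert a (A - insert a T)" using insert by auto
    have "mixed w B T (\<lambda>b. ?y b + t * w a b) \<ge> ?C * t" if "t > 0" for t
    proof -
      have "(\<Sum>c\<in>A - T. (x(a := t)) c * w c b) = ?y b + t * w a b" for b
        unfolding split using fin by (subst sum.insert) (auto intro!: sum.cong)
      moreover have "(\<Prod>c\<in>A - T. (x(a := t)) c) = t * (\<Prod>a\<in>A - insert a T. x a)"
        unfolding split using fin by (subst prod.insert) (auto intro!: prod.cong)
      moreover have "mixed w B T (\<lambda>b. \<Sum>c\<in>A - T. (x(a := t)) c * w c b) \<ge>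
           exp (- real (card T)) * (\<Prod>c\<in>A - T. (x(a := t)) c)"
        using insert that by (intro insert.IH) auto
      ultimately show ?thesis by (simp add: mult_ac)
    qed
    moreover have "A - insert a T \<noteq> {}" using insert by blast
    then have "?y b > 0" if "b \<in> B" for b
      using that insert pos fin by (intro sum_pos mult_pos_pos) auto
    ultimately have "mixed w B (insert a T) ?y \<ge> ?C * exp (- 1)"
      using insert by (intro mixed_step) auto
    also have "?C * exp (- 1) = exp (- real (card (insert a T))) * (\<Prod>a\<in>A - insert a T. x a)"
      using insert by (simp add: mult_ac mult_exp_exp)
    finally show ?case .
  qed
qed

text \<open>Capacity is applied with all rows but \<open>a\<close> differentiated. The remaining
  \<open>mixed\<close> is a linear form, and its value at \<open>w a\<close> is the expansion of the
  permanent along row \<open>a\<close>.\<close>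

lemma (in positive_matrix) permanent_ge:
  assumes "\<And>a. a \<in> A \<Longrightarrow> (\<Sum>b\<in>B. w a b) = 1" "\<And>b. b \<in> B \<Longrightarrow> (\<Sum>a\<in>A. w a b) = 1"
  shows "permanent w A B \<ge> exp (- real (card A))"
proof (cases "A = {}")
  case True
  then show ?thesis using cards fin by (simp add: permanent_empty)
next
  case False
  then obtain a where a: "a \<in> A" by blast
  define T where "T = A - {a}"
  have T: "finite T" "a \<notin> T" "A = insert a T" using fin a by (auto simp: T_def)
  have cT: "card B = Suc (card T)" using T cards by auto
  have AT: "A - T = {a}" using a by (auto simp: T_def)
  have "exp (- real (card A)) \<le> exp (- real (card T)) * (\<Prod>a\<in>A - T. 1)"
    using fin T by simp
  also have "\<dots> \<le> mixed w B T (\<lambda>b. \<Sum>a\<in>A - T. 1 * w a b)"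
    using a assms by (intro mixed_capacity) (auto simp: T_def)
  also have "\<dots> = mixed w B T (w a)" unfolding AT by simp
  also have "\<dots> = (\<Sum>U\<in>(\<lambda>b. {b}) ` B. permanent w T (B - U) * (\<Prod>b\<in>U. w a b))"
    unfolding mixed_def using fin
  proof (intro sum.mono_neutral_cong_right)
    show "\<forall>U\<in>Pow B - (\<lambda>b. {b}) ` B. of_real (permanent w T (B - U)) * (\<Prod>b\<in>U. w a b) = 0"
    proof
      fix U assume U: "U \<in> Pow B - (\<lambda>b. {b}) ` B"
      then have "card U \<noteq> 1" by (auto simp: card_1_singleton_iff)
      then have "permanent w T (B - U) = 0"
        using card_Diff_perm[of B T U w] U fin T cT by auto
      then show "of_real (permanent w T (B - U)) * (\<Prod>b\<in>U. w a b) = 0" by simp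
    qed
  qed auto
  also have "\<dots> = permanent w A B"
    unfolding T(3) using fin T by (subst sum.reindex) (auto simp: permanent_insert mult.commute)
  finally show ?thesis .
qed

text \<open>Mixing with the uniform matrix keeps the row and column sums and makes all entries
  positive; the permanent is continuous, so the bound survives letting the share
  \<open>\<epsilon>\<close> of the uniform matrix tend to 0.\<close>

theorem permanent_doubly_stochastic_ge:
  assumes fin: "finite A" "finite B" and cards: "card A = card B"
    and nonneg: "\<And>a b. a \<in> A \<Longrightarrow> b \<in> B \<Longrightarrow> w a b \<ge> 0"
    and rows: "\<And>a. a \<in> A \<Longrightarrow> (\<Sum>b\<in>B. w a b) = 1"
    and cols: "\<And>b. b \<in> B \<Longrightarrow> (\<Sum>a\<in>A. w a b) = 1"
  shows "permanent w A B \<ge> exp (- real (card A))"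
proof (cases "A = {}")
  case True
  then show ?thesis using cards fin by (simp add: permanent_empty)
next
  case False
  define N where "N = real (card A)"
  have N: "N > 0" using False fin by (simp add: N_def card_gt_0_iff)
  define w' where "w' = (\<lambda>\<epsilon> a b. (1 - \<epsilon>) * w a b + \<epsilon> / N)"
  have "eventually (\<lambda>\<epsilon>. \<epsilon> \<in> {0<..<1}) (at_right (0::real))"
    by (rule eventually_at_right_real) simp
  then have "eventually (\<lambda>\<epsilon>. permanent (w' \<epsilon>) A B \<ge> exp (- real (card A))) (at_right 0)"
  proof eventually_elim
    case (elim \<epsilon>)
    have "positive_matrix A B (w' \<epsilon>)"
      using fin cards nonneg elim N by unfold_locales (auto simp: w'_def intro!: add_nonneg_pos)
    then show ?case
      using rows cols N cards elim
      by (intro positive_matrix.permanent_ge)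
         (auto simp: w'_def sum.distrib sum_distrib_left[symmetric] N_def)
  qed
  moreover have "((\<lambda>\<epsilon>. permanent (w' \<epsilon>) A B) \<longlongrightarrow> permanent (\<lambda>a b. (1 - 0) * w a b + 0 / N) A B) (at_right 0)"
    unfolding permanent_def w'_def using N by (intro tendsto_intros) auto
  then have "((\<lambda>\<epsilon>. permanent (w' \<epsilon>) A B) \<longlongrightarrow> permanent w A B) (at_right 0)" by simp
  ultimately show ?thesis
    by (intro tendsto_lowerbound[where F = "at_right 0"]) auto
qed

section \<open>Injections into prescribed sets\<close>

text \<open>Systems of distinct representatives for the family \<open>N\<close> over
  \<open>A\<close>.\<close>

definition sdr :: "('a \<Rightarrow> 'b set) \<Rightarrow> 'a set \<Rightarrow> ('a \<Rightarrow> 'b) set" where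
  "sdr N A = {f \<in> Pi\<^sub>E A N. inj_on f A}"

lemma finite_sdr [simp]: "finite A \<Longrightarrow> (\<And>a. a \<in> A \<Longrightarrow> finite (N a)) \<Longrightarrow> finite (sdr N A)"
  unfolding sdr_def by (rule finite_subset[OF _ finite_PiE[of A N]]) auto

text \<open>When \<open>f\<close> is built greedily in the order \<open>h\<close> by uniform random choices, the product is the
  probability of obtaining \<open>f\<close>.\<close>

lemma sum_greedy_probability_le_1:
  fixes h :: "'a \<Rightarrow> nat"
  assumes "finite A" "inj_on h A" "\<And>a. a \<in> A \<Longrightarrow> finite (N a)"
  shows "(\<Sum>f\<in>sdr N A. \<Prod>a\<in>A. 1 / real (card (N a - f ` {a'\<in>A. h a' < h a}))) \<le> 1"
  using assms
proof (induction A rule: finite_ranking_induct[where f = h])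
  case empty
  then show ?case by (simp add: sdr_def)
next
  case (insert x A)
  show ?case
  proof (cases "x \<in> A")
    case True
    then show ?thesis using insert by (simp add: insert_absorb)
  next
    case False
    have less: "h a < h x" if "a \<in> A" for a
      using insert.hyps(2)[OF that] insert.prems(1) that False
      by (metis inj_on_def insertI1 insertI2 le_neq_implies_less)
    define W where "W = (\<lambda>S f a. 1 / real (card (N a - f ` {a'\<in>S. h a' < h a})))"
    have eq: "(\<Prod>a\<in>insert x A. W (insert x A) (f(x := b)) a) = (\<Prod>a\<in>A. W A f a) * (1 / real (card (N x - f ` A)))" for f b
    proof -
      have "{a' \<in> insert x A. h a' < h x} = A" using less by auto
      moreover have "f(x := b) ` A = f ` A" using False by (auto simp: image_iff)
      ultimately have "W (insert x A) (f(x := b)) x = 1 / real (card (N x - f ` A))"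
        by (simp add: W_def)
      moreover have "W (insert x A) (f(x := b)) a = W A f a" if "a \<in> A" for a
      proof -
        have "{a' \<in> insert x A. h a' < h a} = {a' \<in> A. h a' < h a}" using less[OF that] by auto
        moreover have "f(x := b) ` {a' \<in> A. h a' < h a} = f ` {a' \<in> A. h a' < h a}"
          using False by (intro image_cong) auto
        ultimately show ?thesis unfolding W_def by metis
      qed
      then have "(\<Prod>a\<in>A. W (insert x A) (f(x := b)) a) = (\<Prod>a\<in>A. W A f a)" by (rule prod.cong[OF refl])
      ultimately show ?thesis using False insert.hyps by simp
    qed
    have "(\<Sum>f\<in>sdr N (insert x A). \<Prod>a\<in>insert x A. W (insert x A) f a) =
        (\<Sum>(f, b)\<in>(SIGMA f:sdr N A. N x - f ` A). (\<Prod>a\<in>A. W A f a) * (1 / real (card (N x - f ` A))))"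
    proof (rule sum.reindex_bij_witness[where j = "\<lambda>f. (f(x := undefined), f x)" and i = "\<lambda>(f, b). f(x := b)"], goal_cases)
      case (1 f)
      then show ?case by auto
    next
      case (2 f)
      then have f: "f \<in> Pi\<^sub>E (insert x A) N" "inj_on f (insert x A)" by (auto simp: sdr_def)
      have im: "f(x := undefined) ` A = f ` A" using False by (auto simp: image_iff)
      have "inj_on (f(x := undefined)) A"
        using f False by (subst inj_on_cong[of A _ f]) (auto simp: inj_on_insert)
      moreover have "f(x := undefined) \<in> Pi\<^sub>E A N" using f(1) False by (auto simp: PiE_def extensional_def)
      ultimately show ?case using f False by (auto simp: sdr_def im inj_on_insert)
    next
      case (3 p)
      then show ?case using False by (auto simp: sdr_def PiE_def extensional_def fun_eq_iff)
    next
      case (4 p)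
      then obtain f b where p: "p = (f, b)" "f \<in> Pi\<^sub>E A N" "inj_on f A" "b \<in> N x" "b \<notin> f ` A"
        by (auto simp: sdr_def)
      have im: "f(x := b) ` A = f ` A" using False by (auto simp: image_iff)
      have "inj_on (f(x := b)) A" using p False by (subst inj_on_cong[of A _ f]) auto
      then have "inj_on (f(x := b)) (insert x A)" using p False im by auto
      moreover have "f(x := b) \<in> Pi\<^sub>E (insert x A) N" using p(2,4) by (auto simp: PiE_def extensional_def)
      ultimately show ?case using p by (simp add: sdr_def)
    next
      case (5 f)
      have "f = (f(x := undefined))(x := f x)" by simp
      then show ?case using eq[of "f(x := undefined)" "f x"] by simp
    qed
    also have "\<dots> = (\<Sum>f\<in>sdr N A. \<Sum>b\<in>N x - f ` A. (\<Prod>a\<in>A. W A f a) * (1 / real (card (N x - f ` A))))"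
      using insert by (subst sum.Sigma) auto
    \<comment> \<open>The greedy process may get stuck at \<open>x\<close>: then no \<open>b\<close>
      is left and the inner sum is 0. Otherwise the conditional probabilities of the choices for
      \<open>x\<close> add up to 1.\<close>
    also have "\<dots> \<le> (\<Sum>f\<in>sdr N A. \<Prod>a\<in>A. W A f a)"
    proof (rule sum_mono)
      fix f
      have "(\<Prod>a\<in>A. W A f a) \<ge> 0" by (intro prod_nonneg) (auto simp: W_def)
      then show "(\<Sum>b\<in>N x - f ` A. (\<Prod>a\<in>A. W A f a) * (1 / real (card (N x - f ` A)))) \<le> (\<Prod>a\<in>A. W A f a)"
        by (cases "card (N x - f ` A) = 0") auto
    qed
    also have "\<dots> \<le> 1" unfolding W_def using insert by (intro insert.IH) (auto simp: inj_on_insert)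
    finally show ?thesis by (simp add: W_def)
  qed
qed

text \<open>Ranks are counted from the end of the order, since the candidates still free at the turn
  of an element are those used at that turn or later.\<close>

lemma bij_betw_rank:
  fixes h :: "'a \<Rightarrow> nat"
  assumes "finite S" "inj_on h S"
  shows "bij_betw (\<lambda>s. card {s'\<in>S. h s' \<ge> h s}) S {1..card S}"
proof -
  let ?r = "\<lambda>s. card {s'\<in>S. h s' \<ge> h s}"
  have less: "?r t < ?r s" if "s \<in> S" "t \<in> S" "h s < h t" for s t
  proof (rule psubset_card_mono)
    have "s \<in> {s'\<in>S. h s' \<ge> h s}" "s \<notin> {s'\<in>S. h s' \<ge> h t}" using that by auto
    moreover have "{s'\<in>S. h s' \<ge> h t} \<subseteq> {s'\<in>S. h s' \<ge> h s}" using that by auto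
    ultimately show "{s'\<in>S. h s' \<ge> h t} \<subset> {s'\<in>S. h s' \<ge> h s}" by blast
  qed (use assms in simp)
  have "inj_on ?r S"
  proof (intro inj_onI, rule ccontr)
    fix s t assume st: "s \<in> S" "t \<in> S" "?r s = ?r t" "s \<noteq> t"
    then have "h s \<noteq> h t" using assms(2) by (auto dest: inj_onD)
    then consider "h s < h t" | "h t < h s" by linarith
    then show False using less[of s t] less[of t s] st by cases simp_all
  qed
  moreover have "?r ` S \<subseteq> {1..card S}"
    using assms by (auto simp: card_gt_0_iff Suc_le_eq intro!: card_mono)
  ultimately show ?thesis
    by (simp add: bij_betw_def card_image card_subset_eq)
qed

text \<open>In a uniformly random order the rank of \<open>a\<close> within \<open>S\<close> is
  uniform. Composing with the transposition of \<open>a\<close> and \<open>s\<close> shows that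
  every \<open>s\<close> in \<open>S\<close> has the same average as \<open>a\<close>, and for a
  fixed order the elements of \<open>S\<close> take each rank exactly once.\<close>

lemma sum_rank_bijs:
  fixes \<phi> :: "nat \<Rightarrow> real"
  assumes "finite A" "S \<subseteq> A" "a \<in> S"
  shows "real (card S) * (\<Sum>h\<in>bijs A {..<card A}. \<phi> (card {s\<in>S. h s \<ge> h a})) =
         real (card (bijs A {..<card A})) * (\<Sum>i = 1..card S. \<phi> i)"
proof -
  let ?H = "bijs A {..<card A}"
  let ?F = "\<lambda>s. \<Sum>h\<in>?H. \<phi> (card {s'\<in>S. h s' \<ge> h s})"
  have sym: "?F s = ?F a" if "s \<in> S" for s
  proof -
    define \<tau> where "\<tau> = (\<lambda>x. if x = a then s else if x = s then a else x)"
    have \<tau>: "\<tau> (\<tau> x) = x" "\<tau> x \<in> A \<longleftrightarrow> x \<in> A" "\<tau> x \<in> S \<longleftrightarrow> x \<in> S" for x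
      using assms that by (auto simp: \<tau>_def)
    have bij: "bij_betw \<tau> A A"
      by (rule bij_betwI[where g = \<tau>]) (use \<tau> in auto)
    have mem: "h \<circ> \<tau> \<in> ?H" if "h \<in> ?H" for h
    proof -
      have "bij_betw (h \<circ> \<tau>) A {..<card A}"
        using that bij by (auto simp: bijs_def intro: bij_betw_trans)
      moreover have "h \<circ> \<tau> \<in> extensional A"
        using that \<tau>(2) by (auto simp: bijs_def PiE_def extensional_def)
      ultimately show ?thesis by (auto simp: bijs_def PiE_def bij_betw_def)
    qed
    show ?thesis
    proof (rule sum.reindex_bij_witness[where i = "\<lambda>h. h \<circ> \<tau>" and j = "\<lambda>h. h \<circ> \<tau>"], goal_cases)
      case (5 h)
      have "\<tau> a = s" by (simp add: \<tau>_def)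
      from this \<tau> have "bij_betw \<tau> {s' \<in> S. (h \<circ> \<tau>) a \<le> (h \<circ> \<tau>) s'} {s' \<in> S. h s \<le> h s'}"
        by (intro bij_betwI[where g = \<tau>]) simp_all
      then show ?case using bij_betw_same_card by metis
    qed (use mem \<tau>(1) in \<open>auto simp: fun_eq_iff\<close>)
  qed
  have "real (card S) * ?F a = (\<Sum>s\<in>S. ?F s)" using sym by simp
  also have "\<dots> = (\<Sum>h\<in>?H. \<Sum>s\<in>S. \<phi> (card {s'\<in>S. h s' \<ge> h s}))" by (rule sum.swap)
  also have "\<dots> = (\<Sum>h\<in>?H. \<Sum>i = 1..card S. \<phi> i)"
  proof (rule sum.cong[OF refl])
    fix h assume "h \<in> ?H"
    then have "inj_on h S" using assms by (auto simp: bijs_def bij_betw_def intro: inj_on_subset)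
    then show "(\<Sum>s\<in>S. \<phi> (card {s'\<in>S. h s' \<ge> h s})) = (\<Sum>i = 1..card S. \<phi> i)"
      using assms by (intro sum.reindex_bij_betw bij_betw_rank) (auto intro: finite_subset)
  qed
  finally show ?thesis by simp
qed

text \<open>A Bregman-type bound: averaging the greedy probabilities over all orders, the number of
  candidates left for \<open>a\<close> is \<open>u + i\<close> with \<open>i\<close> uniform in \<open>{1..card (N a) - u}\<close>, where \<open>u\<close> counts the
  elements of \<open>N a\<close> outside the range of \<open>f\<close>.\<close>

theorem card_sdr_le:
  fixes N :: "'a \<Rightarrow> 'b set" and L :: real
  defines "u \<equiv> \<lambda>f A a. card (N a - f ` A)"
  assumes "finite A" and fin: "\<And>a. a \<in> A \<Longrightarrow> finite (N a)"
    and L: "\<And>f. f \<in> sdr N A \<Longrightarrow>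
      (\<Sum>a\<in>A. (\<Sum>i = u f A a + 1..card (N a). ln (real i)) / real (card (N a) - u f A a)) \<le> L"
  shows "real (card (sdr N A)) \<le> exp L"
proof -
  let ?H = "bijs A {..<card A}"
  let ?M = "sdr N A"
  define c where "c = real (card ?H)"
  define v where "v = (\<lambda>f (h :: 'a \<Rightarrow> nat) a. card (N a - f ` {a'\<in>A. h a' < h a}))"
  obtain h0 where "bij_betw h0 A {..<card A}"
    using ex_bij_betw_finite_nat[OF assms(2)] by (auto simp: atLeast0LessThan)
  then have "restrict h0 A \<in> ?H" by (auto simp: bijs_def bij_betw_def inj_on_def)
  then have c: "c > 0" using assms(2) by (auto simp: c_def card_gt_0_iff)
  have v: "v f h a > 0" if "f \<in> ?M" "a \<in> A" for f h a
  proof -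
    have "f a \<notin> f ` {a'\<in>A. h a' < h a}"
      using that by (subst inj_on_image_mem_iff[of f A]) (auto simp: sdr_def)
    moreover have "f a \<in> N a" using that by (auto simp: sdr_def)
    ultimately have "f a \<in> N a - f ` {a'\<in>A. h a' < h a}" by (rule DiffI[rotated])
    then have "N a - f ` {a'\<in>A. h a' < h a} \<noteq> {}" by blast
    then show ?thesis unfolding v_def using fin[OF that(2)] by (simp add: card_gt_0_iff)
  qed
  have avg: "(\<Sum>h\<in>?H. \<Sum>a\<in>A. ln (real (v f h a))) / c \<le> L" if f: "f \<in> ?M" for f
  proof -
    have "(\<Sum>h\<in>?H. ln (real (v f h a))) / c =
        (\<Sum>i = u f A a + 1..card (N a). ln (real i)) / real (card (N a) - u f A a)" if a: "a \<in> A" for a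
    proof -
      let ?S = "{a'\<in>A. f a' \<in> N a}"
      have inj: "inj_on f A" and fa: "f a \<in> N a" using f a by (auto simp: sdr_def)
      have S: "finite ?S" "card ?S > 0" using assms(2) a fa by (auto simp: card_gt_0_iff)
      \<comment> \<open>The candidates free at the turn of \<open>a\<close> are those that
        \<open>f\<close> never uses, \<open>u f A a\<close> in number, and those used by some
        element placed at \<open>a\<close> or later.\<close>
      have vS: "v f h a = u f A a + card {s\<in>?S. h s \<ge> h a}" for h
      proof -
        have "N a - f ` {a'\<in>A. h a' < h a} = (N a - f ` A) \<union> f ` {s\<in>?S. h s \<ge> h a}"
        proof (intro equalityI subsetI)
          fix x assume x: "x \<in> N a - f ` {a'\<in>A. h a' < h a}"
          show "x \<in> (N a - f ` A) \<union> f ` {s\<in>?S. h s \<ge> h a}"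
          proof (cases "x \<in> f ` A")
            case True
            then obtain s where s: "x = f s" "s \<in> A" by blast
            then have "h s \<ge> h a" using x by (metis (mono_tags, lifting) DiffE imageI linorder_le_less_linear mem_Collect_eq)
            moreover have "f s \<in> N a" using s x by simp
            ultimately have "f s \<in> f ` {s\<in>?S. h s \<ge> h a}" using s(2) by (intro imageI) simp
            then show ?thesis using s(1) by simp
          qed (use x in blast)
        next
          fix x assume "x \<in> (N a - f ` A) \<union> f ` {s\<in>?S. h s \<ge> h a}"
          then consider "x \<in> N a - f ` A" | s where "x = f s" "s \<in> A" "f s \<in> N a" "h s \<ge> h a" by blast
          then show "x \<in> N a - f ` {a'\<in>A. h a' < h a}"
          proof cases
            case 2
            then have "f s \<notin> f ` {a'\<in>A. h a' < h a}"
              by (subst inj_on_image_mem_iff[OF inj]) auto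
            then show ?thesis using 2(1,3) by simp
          qed blast
        qed
        moreover have "card (f ` {s\<in>?S. h s \<ge> h a}) = card {s\<in>?S. h s \<ge> h a}"
          by (rule card_image, rule inj_on_subset[OF inj]) auto
        ultimately show ?thesis unfolding v_def u_def using fin[OF a] assms(2)
          by (simp, subst card_Un_disjoint) auto
      qed
      have "(N a - f ` A) \<union> f ` ?S = N a" by auto
      then have "card (N a) = card ((N a - f ` A) \<union> f ` ?S)" by (rule arg_cong[OF sym])
      also have "\<dots> = u f A a + card (f ` ?S)"
        using fin[OF a] S by (subst card_Un_disjoint) (auto simp: u_def)
      also have "card (f ` ?S) = card ?S" by (rule card_image, rule inj_on_subset[OF inj]) auto
      finally have cN: "card (N a) = u f A a + card ?S" .
      have "real (card ?S) * (\<Sum>h\<in>?H. ln (real (v f h a))) = c * (\<Sum>i = 1..card ?S. ln (real (u f A a + i)))"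
        unfolding vS c_def using assms(2) a fa
        by (intro sum_rank_bijs[where \<phi> = "\<lambda>i. ln (real (u f A a + i))"]) auto
      also have "(\<Sum>i = 1..card ?S. ln (real (u f A a + i))) = (\<Sum>i = u f A a + 1..card (N a). ln (real i))"
        unfolding cN using sum.shift_bounds_cl_nat_ivl[of "\<lambda>i. ln (real i)" 1 "u f A a" "card ?S"]
        by (simp add: add.commute)
      finally show ?thesis using c S(2) unfolding cN
        by (subst frac_eq_eq) (simp_all add: mult.commute)
    qed
    then have "(\<Sum>a\<in>A. (\<Sum>h\<in>?H. ln (real (v f h a))) / c) =
      (\<Sum>a\<in>A. (\<Sum>i = u f A a + 1..card (N a). ln (real i)) / real (card (N a) - u f A a))"
      by (rule sum.cong[OF refl])
    also have "\<dots> \<le> L" by (rule L[OF f])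
    finally have "(\<Sum>a\<in>A. (\<Sum>h\<in>?H. ln (real (v f h a))) / c) \<le> L" .
    moreover have "(\<Sum>h\<in>?H. \<Sum>a\<in>A. ln (real (v f h a))) / c = (\<Sum>a\<in>A. (\<Sum>h\<in>?H. ln (real (v f h a))) / c)"
      by (subst sum.swap) (simp add: sum_divide_distrib)
    ultimately show ?thesis by simp
  qed
  \<comment> \<open>By Jensen's inequality for \<open>exp\<close>, the probability of
    \<open>f\<close> averaged over the orders is at least the exponential of the averaged logarithm.
    For each order these probabilities add up to at most 1, which limits the number of
    \<open>f\<close>.\<close>
  have "exp (- L) \<le> (\<Sum>h\<in>?H. \<Prod>a\<in>A. 1 / real (v f h a)) / c" if f: "f \<in> ?M" for f
  proof -
    have "exp (- L) \<le> exp (\<Sum>h\<in>?H. (1 / c) *\<^sub>R (- (\<Sum>a\<in>A. ln (real (v f h a)))))"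
      using avg[OF f] by (simp add: sum_negf sum_divide_distrib)
    also have "\<dots> \<le> (\<Sum>h\<in>?H. (1 / c) * exp (- (\<Sum>a\<in>A. ln (real (v f h a)))))"
      using c assms(2) fin by (intro convex_on_sum[OF _ _ exp_convex]) (auto simp: c_def card_gt_0_iff)
    also have "\<dots> = (\<Sum>h\<in>?H. (1 / c) * (\<Prod>a\<in>A. 1 / real (v f h a)))"
      using assms(2) v[OF f] by (simp add: sum_negf[symmetric] exp_sum exp_minus inverse_eq_divide)
    finally show ?thesis by (simp add: sum_divide_distrib)
  qed
  then have "real (card ?M) * exp (- L) \<le> (\<Sum>f\<in>?M. (\<Sum>h\<in>?H. \<Prod>a\<in>A. 1 / real (v f h a)) / c)"
    using sum_bounded_below[of ?M "exp (- L)"] by simp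
  also have "\<dots> = (\<Sum>h\<in>?H. \<Sum>f\<in>?M. \<Prod>a\<in>A. 1 / real (v f h a)) / c"
    by (subst sum.swap) (simp add: sum_divide_distrib)
  also have "\<dots> \<le> (\<Sum>h\<in>?H. 1) / c"
    unfolding v_def using c assms(2) fin
    by (intro divide_right_mono sum_mono sum_greedy_probability_le_1) (auto simp: bijs_def bij_betw_def)
  also have "\<dots> = 1" using c by (simp add: c_def)
  finally have "real (card ?M) * exp (- L) * exp L \<le> 1 * exp L" by (intro mult_right_mono) simp_all
  then show ?thesis by (simp only: mult.assoc mult_exp_exp) simp
qed

section \<open>Decompositions and their covering pairs\<close>

text \<open>A symmetric chain without its indexing: one set on each level from \<open>k\<close> to
  \<open>n - k\<close>. Inclusions between consecutive levels are enough, the others follow by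
  transitivity.\<close>

definition levelled :: "nat \<Rightarrow> nat \<Rightarrow> nat set set \<Rightarrow> bool" where
  "levelled n k c \<longleftrightarrow> 2 * k \<le> n \<and> c \<subseteq> Pow {1..n} \<and> bij_betw card c {k..n - k} \<and>
     (\<forall>x\<in>c. \<forall>y\<in>c. card y = Suc (card x) \<longrightarrow> x \<subset> y)"

lemma symmetric_chain_iff: "symmetric_chain n c \<longleftrightarrow> (\<exists>k. levelled n k c)"
proof
  assume "symmetric_chain n c"
  then obtain K C where C: "c = C ` {0..K}" "\<And>i. i \<in> {0..K} \<Longrightarrow> C i \<in> Pow {1..n}"
      "\<And>i. i < K \<Longrightarrow> C i \<subset> C (Suc i)" "card (C 0) + card (C K) = n"
      "\<And>i. i \<in> {1..K} \<Longrightarrow> card (C i) = card (C 0) + i"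
    unfolding symmetric_chain_def by blast
  define k where "k = card (C 0)"
  have card: "card (C i) = k + i" if "i \<le> K" for i
    using C(5)[of i] that by (cases "i = 0") (auto simp: k_def)
  have n: "n = k + (k + K)" using C(4) card[of K] card[of 0] by simp
  have "inj_on card c" unfolding C(1) by (rule inj_onI) (auto simp: card)
  moreover have "card ` c = (\<lambda>i. k + i) ` {0..K}"
    unfolding C(1) image_image by (intro image_cong) (auto simp: card)
  then have "card ` c = {k..n - k}" by (simp add: n add.commute)
  moreover have "\<forall>x\<in>c. \<forall>y\<in>c. card y = Suc (card x) \<longrightarrow> x \<subset> y"
  proof (intro ballI impI)
    fix x y assume "x \<in> c" "y \<in> c" and xy: "card y = Suc (card x)"
    then obtain i j where ij: "x = C i" "y = C j" "i \<le> K" "j \<le> K" unfolding C(1) by auto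
    then have "j = Suc i" using xy card by simp
    then show "x \<subset> y" using C(3)[of i] ij by simp
  qed
  ultimately have "levelled n k c" using C(2) n unfolding levelled_def bij_betw_def C(1)
    by (intro conjI) (use C(2) in \<open>simp; fail | blast\<close>)+
  then show "\<exists>k. levelled n k c" ..
next
  assume "\<exists>k. levelled n k c"
  then obtain k where k: "2 * k \<le> n" "c \<subseteq> Pow {1..n}" "bij_betw card c {k..n - k}"
    and ch: "\<And>x y. x \<in> c \<Longrightarrow> y \<in> c \<Longrightarrow> card y = Suc (card x) \<Longrightarrow> x \<subset> y"
    unfolding levelled_def by blast
  define K where "K = n - 2 * k"
  define C where "C = (\<lambda>i. inv_into c card (k + i))"
  have "bij_betw (inv_into c card) {k..n - k} c" using k(3) by (rule bij_betw_inv_into)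
  moreover have "{k..n - k} = (\<lambda>i. k + i) ` {0..K}" using k(1) by (simp add: K_def)
  ultimately have "inv_into c card ` ((\<lambda>i. k + i) ` {0..K}) = c" by (simp only: bij_betw_def)
  then have c: "c = C ` {0..K}" by (simp only: image_image C_def)
  have card: "card (C i) = k + i" if "i \<le> K" for i
    unfolding C_def using k that by (intro bij_betw_inv_into_right[OF k(3)]) (auto simp: K_def)
  have "C i \<subset> C (Suc i)" if "i < K" for i
    using that c card[of i] card[of "Suc i"] by (intro ch) auto
  moreover have "card (C 0) + card (C K) = n" using card[of 0] card[of K] k(1) by (simp add: K_def)
  moreover have "\<forall>i\<in>{0..K}. C i \<in> Pow {1..n}" using c k(2) by blast
  moreover have "\<forall>i\<in>{1..K}. card (C i) = card (C 0) + i" using card[of 0] card by simp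
  ultimately show "symmetric_chain n c" unfolding symmetric_chain_def using c by blast
qed

lemma levelled_unique:
  assumes "levelled n k c" "x \<in> c" "y \<in> c" "card x = card y"
  shows "x = y"
  using assms by (auto simp: levelled_def bij_betw_def dest: inj_onD)

lemma levelled_card:
  assumes "levelled n k c" "x \<in> c"
  shows "k \<le> card x" "card x \<le> n - k" "x \<subseteq> {1..n}"
  using assms by (auto simp: levelled_def bij_betw_def)

lemma levelled_ex:
  assumes "levelled n k c" "k \<le> i" "i \<le> n - k"
  shows "\<exists>x\<in>c. card x = i"
proof -
  have "i \<in> card ` c" using assms by (simp add: levelled_def bij_betw_def)
  then show ?thesis by auto
qed

lemma partition_on_same_part:
  assumes "partition_on X P" "c \<in> P" "c' \<in> P" "x \<in> c" "x \<in> c'"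
  shows "c = c'"
  using partition_onD2[OF assms(1)] assms(2-) by (auto simp: disjoint_def)

text \<open>Consecutive members of one chain. A symmetric chain decomposition is determined by this
  relation, and it splits into the successor map below the middle and the predecessor map above
  it.\<close>

definition covers :: "nat set set set \<Rightarrow> nat set \<Rightarrow> nat set \<Rightarrow> bool" where
  "covers P a b \<longleftrightarrow> (\<exists>c\<in>P. a \<in> c \<and> b \<in> c \<and> card b = Suc (card a))"

context
  fixes n :: nat and P :: "nat set set set"
  assumes P: "symmetric_chain_decomposition n P"
begin

lemma scd_partition: "partition_on (Pow {1..n}) P"
  using P by (simp add: symmetric_chain_decomposition_def)

lemma scd_levelled:
  assumes "x \<subseteq> {1..n}"
  obtains c k where "c \<in> P" "x \<in> c" "levelled n k c"
proof -
  have "x \<in> \<Union>P" using partition_onD1[OF scd_partition] assms by blast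
  then obtain c where "c \<in> P" "x \<in> c" by blast
  then show ?thesis using that P by (auto simp: symmetric_chain_decomposition_def symmetric_chain_iff)
qed

lemma scd_part_levelled: "c \<in> P \<Longrightarrow> \<exists>k. levelled n k c"
  using P by (auto simp: symmetric_chain_decomposition_def symmetric_chain_iff)

lemma covers_subset:
  assumes "covers P a b"
  shows "a \<subset> b" "card b = Suc (card a)" "b \<subseteq> {1..n}"
proof -
  obtain c where c: "c \<in> P" "a \<in> c" "b \<in> c" "card b = Suc (card a)"
    using assms by (auto simp: covers_def)
  moreover obtain k where "levelled n k c" using scd_part_levelled c by blast
  ultimately show "a \<subset> b" "card b = Suc (card a)" "b \<subseteq> {1..n}"
    by (auto simp: levelled_def)
qed

lemma covers_unique:
  assumes "covers P a b" "covers P a' b'"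
  shows "a = a' \<longleftrightarrow> b = b'"
proof -
  obtain c where c: "c \<in> P" "a \<in> c" "b \<in> c" "card b = Suc (card a)"
    using assms by (auto simp: covers_def)
  obtain c' where c': "c' \<in> P" "a' \<in> c'" "b' \<in> c'" "card b' = Suc (card a')"
    using assms by (auto simp: covers_def)
  obtain k where k: "levelled n k c" using scd_part_levelled c by blast
  show ?thesis
    using c c' partition_on_same_part[OF scd_partition, of c c'] levelled_unique[OF k] by (metis Suc_inject)
qed

text \<open>A symmetric chain does not end below the middle: from \<open>k \<le> card a\<close> and
  \<open>2 * card a < n\<close> one gets \<open>Suc (card a) \<le> n - k\<close>.\<close>

lemma covers_ex_up:
  assumes "a \<subseteq> {1..n}" "2 * card a < n"
  shows "\<exists>b. covers P a b"
proof -
  obtain c k where c: "c \<in> P" "a \<in> c" "levelled n k c" using scd_levelled assms by blast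
  have "k \<le> card a" using levelled_card[OF c(3,2)] by blast
  then have "k \<le> Suc (card a)" "Suc (card a) \<le> n - k" using assms(2) by linarith+
  then obtain b where "b \<in> c" "card b = Suc (card a)" using levelled_ex[OF c(3)] by blast
  then show ?thesis using c by (auto simp: covers_def)
qed

lemma covers_ex_down:
  assumes "b \<subseteq> {1..n}" "2 * card b > n"
  shows "\<exists>a. covers P a b"
proof -
  obtain c k where c: "c \<in> P" "b \<in> c" "levelled n k c" using scd_levelled assms by blast
  have "card b \<le> n - k" using levelled_card[OF c(3,2)] by blast
  then have "k \<le> card b - 1" "card b - 1 \<le> n - k" using assms(2) by linarith+
  then obtain a where "a \<in> c" "card a = card b - 1" using levelled_ex[OF c(3)] by blast
  then have "a \<in> c \<and> b \<in> c \<and> card b = Suc (card a)" using c(2) assms(2) by simp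
  then show ?thesis using c(1) unfolding covers_def by blast
qed

end

text \<open>Climbing a chain of \<open>P\<close> from its lowest set, each covering step remains in
  the part of \<open>P'\<close> that contains this lowest set. Used in both directions, this shows
  that equal covering relations give equal decompositions.\<close>

lemma scd_refines_if_covers_imp:
  assumes P: "symmetric_chain_decomposition n P" and P': "symmetric_chain_decomposition n P'"
    and covers: "\<And>a b. covers P a b \<Longrightarrow> covers P' a b"
  shows "\<forall>c\<in>P. \<exists>c'\<in>P'. c \<subseteq> c'"
proof
  fix c assume c: "c \<in> P"
  obtain k where k: "levelled n k c" using scd_part_levelled[OF P c] by blast
  then have "2 * k \<le> n" by (simp add: levelled_def)
  then have "k \<le> n - k" by linarith
  then obtain x where x: "x \<in> c" "card x = k" using levelled_ex[OF k order.refl] by blast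
  obtain c' where c': "c' \<in> P'" "x \<in> c'" using scd_levelled[OF P'] levelled_card[OF k x(1)] by metis
  have "y \<in> c'" if "y \<in> c" "card y = k + i" for y i
    using that
  proof (induction i arbitrary: y)
    case 0
    then show ?case using levelled_unique[OF k, of y x] x c' by simp
  next
    case (Suc i)
    have "k + i \<le> n - k" using levelled_card[OF k Suc.prems(1)] Suc.prems(2) by simp
    then obtain z where z: "z \<in> c" "card z = k + i" using levelled_ex[OF k, of "k + i"] by auto
    then have "covers P' z y" using c Suc.prems by (intro covers) (auto simp: covers_def)
    then obtain d where "d \<in> P'" "z \<in> d" "y \<in> d" by (auto simp: covers_def)
    then show ?case using Suc.IH[OF z] partition_on_same_part[OF scd_partition[OF P'], of d c'] c' by blast
  qed
  then have "c \<subseteq> c'" using levelled_card(1)[OF k] by (metis le_Suc_ex subsetI)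
  then show "\<exists>c'\<in>P'. c \<subseteq> c'" using c' by blast
qed

lemma partition_on_subset_if_refines:
  assumes P: "partition_on X P" and P': "partition_on X P'"
    and "\<forall>c\<in>P. \<exists>c'\<in>P'. c \<subseteq> c'" "\<forall>c\<in>P'. \<exists>c'\<in>P. c \<subseteq> c'"
  shows "P \<subseteq> P'"
proof
  fix c assume c: "c \<in> P"
  then obtain c' c'' where c': "c' \<in> P'" "c \<subseteq> c'" "c'' \<in> P" "c' \<subseteq> c''" using assms by meson
  moreover obtain x where "x \<in> c" using partition_onD3[OF P] c by (metis all_not_in_conv)
  ultimately have "c = c''" using partition_on_same_part[OF P c, of c'' x] by blast
  then show "c \<in> P'" using c' by auto
qed

section \<open>Encoding a decomposition by two injections\<close>

definition lower_half :: "nat \<Rightarrow> nat set set" where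
  "lower_half n = {a \<in> Pow {1..n}. 2 * card a < n}"

definition up_nbrs :: "nat \<Rightarrow> nat set \<Rightarrow> nat set set" where
  "up_nbrs n a = {b \<in> Pow {1..n}. a \<subset> b \<and> card b = Suc (card a)}"

lemma finite_lower_half [simp]: "finite (lower_half n)"
  by (simp add: lower_half_def)

lemma finite_up_nbrs [simp]: "finite (up_nbrs n a)"
  by (simp add: up_nbrs_def)

text \<open>A covering pair is read off from \<open>up P\<close> when its smaller set is below the
  middle, and from \<open>dn P\<close> otherwise, so the two maps determine \<open>P\<close>. Both
  lie in the same \<open>sdr\<close>, hence the square.\<close>

lemma num_scd_le: "num_scd n \<le> card (sdr (up_nbrs n) (lower_half n)) ^ 2"
proof -
  let ?A = "lower_half n" and ?M = "sdr (up_nbrs n) (lower_half n)"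
  define up where "up = (\<lambda>P. \<lambda>a\<in>?A. SOME b. covers P a b)"
  \<comment> \<open>The predecessor map above the middle, conjugated by complementation: the
    complement of \<open>a\<close> is above the middle, and the complement of its predecessor is an
    upper neighbour of \<open>a\<close>.\<close>
  define dn where "dn = (\<lambda>P. \<lambda>a\<in>?A. {1..n} - (SOME x. covers P x ({1..n} - a)))"
  have up: "covers P a (up P a)" if "symmetric_chain_decomposition n P" "a \<in> ?A" for P a
    using covers_ex_up[OF that(1), of a] that(2) by (auto simp: up_def lower_half_def intro: someI)
  have compl: "card ({1..n} - a) = n - card a" "card a \<le> n" if "a \<subseteq> {1..n}" for a
    using that card_mono[of "{1..n}" a] by (auto simp: card_Diff_subset finite_subset)
  have dn: "covers P ({1..n} - dn P a) ({1..n} - a)" "dn P a \<subseteq> {1..n}"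
    if P: "symmetric_chain_decomposition n P" and a: "a \<in> ?A" for P a
  proof -
    let ?x = "SOME x. covers P x ({1..n} - a)"
    have "\<exists>x. covers P x ({1..n} - a)"
      using a compl[of a] by (intro covers_ex_down[OF P]) (auto simp: lower_half_def)
    then have x: "covers P ?x ({1..n} - a)" by (rule someI_ex)
    then have "{1..n} - dn P a = ?x" using covers_subset[OF P x] a by (auto simp: dn_def)
    then show "covers P ({1..n} - dn P a) ({1..n} - a)" using x by simp
    show "dn P a \<subseteq> {1..n}" using a by (auto simp: dn_def)
  qed
  have "up P \<in> ?M" if P: "symmetric_chain_decomposition n P" for P
  proof -
    have "inj_on (up P) ?A"
      by (rule inj_onI) (metis covers_unique[OF P] up[OF P])
    moreover have "up P a \<in> up_nbrs n a" if "a \<in> ?A" for a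
      using covers_subset[OF P up[OF P that]] by (auto simp: up_nbrs_def)
    ultimately show ?thesis by (auto simp: sdr_def up_def)
  qed
  moreover have "dn P \<in> ?M" if P: "symmetric_chain_decomposition n P" for P
  proof -
    have "inj_on (dn P) ?A"
    proof (rule inj_onI)
      fix a a' assume a: "a \<in> ?A" "a' \<in> ?A" "dn P a = dn P a'"
      then have "{1..n} - a = {1..n} - a'"
        using covers_unique[OF P dn(1)[OF P a(1)] dn(1)[OF P a(2)]] by simp
      then show "a = a'" using a(1,2) by (auto simp: lower_half_def)
    qed
    moreover have "dn P a \<in> up_nbrs n a" if a: "a \<in> ?A" for a
    proof -
      note c = covers_subset[OF P dn(1)[OF P a]] and d = dn(2)[OF P a]
      have "a \<subseteq> {1..n}" using a by (simp add: lower_half_def)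
      then have "a \<subset> dn P a" using c(1) d by blast
      moreover have "card (dn P a) = Suc (card a)"
        using c(2) compl[OF d] compl[OF \<open>a \<subseteq> {1..n}\<close>] by linarith
      ultimately show ?thesis using d by (simp add: up_nbrs_def)
    qed
    ultimately show ?thesis by (auto simp: sdr_def dn_def)
  qed
  moreover have "inj_on (\<lambda>P. (up P, dn P)) {P. symmetric_chain_decomposition n P}"
  proof -
    have cov: "covers P' a b" if P: "symmetric_chain_decomposition n P" "symmetric_chain_decomposition n P'"
      and eq: "up P = up P'" "dn P = dn P'" and ab: "covers P a b" for P P' a b
    proof (cases "2 * card a < n")
      case True
      then have a: "a \<in> ?A" using covers_subset[OF P(1) ab] by (auto simp: lower_half_def)
      then have "up P a = b" using covers_unique[OF P(1) ab up[OF P(1) a]] by simp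
      then show ?thesis using up[OF P(2) a] eq by simp
    next
      case False
      define a' where "a' = {1..n} - b"
      have b: "b \<subseteq> {1..n}" "card b = Suc (card a)" using covers_subset[OF P(1) ab] by auto
      then have b': "b = {1..n} - a'" by (auto simp: a'_def)
      have a: "a' \<in> ?A" using compl[OF b(1)] False b(2) by (auto simp: lower_half_def a'_def)
      then have "{1..n} - dn P a' = a" using covers_unique[OF P(1) ab dn(1)[OF P(1) a]] b' by simp
      then show ?thesis using dn(1)[OF P(2) a] eq b' by simp
    qed
    have ref: "\<forall>c\<in>P. \<exists>c'\<in>P'. c \<subseteq> c'"
      if "symmetric_chain_decomposition n P" "symmetric_chain_decomposition n P'"
        "up P = up P'" "dn P = dn P'" for P P'
      by (rule scd_refines_if_covers_imp[OF that(1,2) cov[OF that]])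
    have sub: "P \<subseteq> P'"
      if "symmetric_chain_decomposition n P" "symmetric_chain_decomposition n P'"
        "up P = up P'" "dn P = dn P'" for P P'
      by (rule partition_on_subset_if_refines[OF scd_partition[OF that(1)] scd_partition[OF that(2)]
            ref[OF that] ref[OF that(2,1) that(3,4)[symmetric]]])
    show ?thesis
      by (rule inj_onI) (use sub in \<open>simp add: set_eq_subset\<close>)
  qed
  ultimately have "num_scd n \<le> card (?M \<times> ?M)"
    unfolding num_scd_def by (intro card_inj_on_le[where f = "\<lambda>P. (up P, dn P)"]) auto
  then show ?thesis by (simp add: card_cartesian_product power2_eq_square)
qed

section \<open>The upper bound\<close>

lemma ln_le_half: "x > 0 \<Longrightarrow> ln (x::real) \<le> x / 2"
  using ln_le_minus_one[of "x / 2"] ln_2_less_1 by (simp add: ln_div)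

lemma ln_le_sqrt: "x > 0 \<Longrightarrow> ln (x::real) \<le> sqrt x"
  using ln_le_half[of "sqrt x"] by (simp add: ln_sqrt)

text \<open>Both parts are \<open>ln x \<le> x - 1\<close>, at \<open>x = d / (d + 1)\<close> and at
  \<open>x = (d + 1) / d\<close>. They are the induction steps of the two Stirling-type bounds that
  follow.\<close>

lemma ln_Suc_bounds:
  assumes "d > 0"
  shows "1 \<le> real (Suc d) * (ln (real (Suc d)) - ln (real d))" "real d * (ln (real (Suc d)) - ln (real d)) \<le> 1"
proof -
  have eq: "ln (real (Suc d)) - ln (real d) = ln (real (Suc d) / real d)"
    using assms by (simp add: ln_div)
  have "1 - real d / real (Suc d) \<le> - ln (real d / real (Suc d))"
    using ln_le_minus_one[of "real d / real (Suc d)"] assms by simp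
  then have "1 - real d / real (Suc d) \<le> ln (real (Suc d)) - ln (real d)"
    using assms by (simp add: ln_div)
  then have "real (Suc d) * (1 - real d / real (Suc d)) \<le> real (Suc d) * (ln (real (Suc d)) - ln (real d))"
    by (rule mult_left_mono) simp
  then show "1 \<le> real (Suc d) * (ln (real (Suc d)) - ln (real d))"
    by (simp add: right_diff_distrib)
  have "ln (real (Suc d)) - ln (real d) \<le> real (Suc d) / real d - 1"
    unfolding eq using assms by (intro ln_le_minus_one) simp
  then have "real d * (ln (real (Suc d)) - ln (real d)) \<le> real d * (real (Suc d) / real d - 1)"
    by (rule mult_left_mono) simp
  then show "real d * (ln (real (Suc d)) - ln (real d)) \<le> 1"
    using assms by (simp add: right_diff_distrib)
qed

lemma sum_ln_upper: "d > 0 \<Longrightarrow> (\<Sum>i = 1..d. ln (real i)) \<le> real d * ln (real d) - real d + ln (real d) + 1"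
proof (induction d rule: nat_induct_non_zero)
  case (Suc d)
  then show ?case using ln_Suc_bounds(1)[of d] by (simp add: algebra_simps)
qed simp

lemma sum_ln_lower: "(\<Sum>i = 1..d. ln (real i)) \<ge> real d * ln (real d) - real d"
proof (induction d)
  case (Suc d)
  then show ?case
    using ln_Suc_bounds(2)[of d] by (cases "d = 0") (simp_all add: algebra_simps)
qed simp

text \<open>For \<open>2 * u \<le> d\<close> the Stirling-type bounds leave an error
  \<open>u * ln (d / u)\<close>, at most \<open>d * sqrt (u / d)\<close> because
  \<open>ln y \<le> sqrt y\<close>, and dividing by \<open>d - u \<ge> d / 2\<close> at most doubles
  it. For larger \<open>u\<close> the trivial bound \<open>ln d\<close> suffices, since
  \<open>2 * sqrt (u / d) \<ge> 1\<close> makes up for the \<open>- 1\<close>.\<close>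

lemma avg_ln_le:
  assumes "u < d"
  shows "(\<Sum>i = u + 1..d. ln (real i)) / real (d - u) \<le>
    ln (real d) - 1 + 2 * sqrt (real u / real d) + 2 * (ln (real d) + 1) / real d"
proof (cases "2 * u \<le> d")
  case True
  have d: "d > 0" using assms by simp
  then have ln0: "ln (real d) \<ge> 0" by simp
  define D where "D = real d"
  define x where "x = real u"
  have x: "0 \<le> x" "2 * x \<le> D" "D > 0" using True d by (auto simp: x_def D_def)
  have "{1..d} = {1..u} \<union> {u + 1..d}" using assms by auto
  then have "(\<Sum>i = 1..d. ln (real i)) = (\<Sum>i = 1..u. ln (real i)) + (\<Sum>i = u + 1..d. ln (real i))"
    by (simp add: sum.union_disjoint)
  then have "(\<Sum>i = u + 1..d. ln (real i)) \<le> D * ln D - D + ln D + 1 - (x * ln x - x)"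
    using sum_ln_upper[OF d] sum_ln_lower[of u] by (simp add: D_def x_def)
  also have "\<dots> = (D - x) * (ln D - 1) + (x * (ln D - ln x) + ln D + 1)" by (simp add: algebra_simps)
  also have "x * (ln D - ln x) \<le> sqrt (x / D) * D"
  proof (cases "x = 0")
    case False
    then have "x * (ln D - ln x) = x * ln (D / x)" using x by (simp add: ln_div)
    also have "\<dots> \<le> x * sqrt (D / x)" using x False by (intro mult_left_mono ln_le_sqrt) auto
    also have "\<dots> = sqrt (x / D) * D"
    proof -
      have "x * sqrt (D / x) = sqrt (x\<^sup>2 * (D / x))" using x
        by (simp only: real_sqrt_mult real_sqrt_abs abs_of_nonneg)
      also have "x\<^sup>2 * (D / x) = D\<^sup>2 * (x / D)" using x False by (simp add: power2_eq_square)
      also have "sqrt \<dots> = sqrt (x / D) * D" using x by (simp add: real_sqrt_mult real_sqrt_divide)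
      finally show ?thesis .
    qed
    finally show ?thesis .
  qed simp
  finally have "(\<Sum>i = u + 1..d. ln (real i)) / (D - x) \<le>
      ((D - x) * (ln D - 1) + (sqrt (x / D) * D + ln D + 1)) / (D - x)"
    using x by (intro divide_right_mono) simp_all
  also have "\<dots> = ln D - 1 + (sqrt (x / D) * D + ln D + 1) / (D - x)"
    using x by (simp add: add_divide_distrib)
  also have "(sqrt (x / D) * D + ln D + 1) / (D - x) \<le> (sqrt (x / D) * D + ln D + 1) / (D / 2)"
    using x ln0 by (intro divide_left_mono add_nonneg_nonneg mult_nonneg_nonneg mult_pos_pos) (auto simp: D_def)
  also have "\<dots> = 2 * sqrt (x / D) + 2 * (ln D + 1) / D"
    using x by (simp add: field_simps)
  finally show ?thesis using assms by (simp add: D_def x_def of_nat_diff algebra_simps)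
next
  case False
  have d: "d > 0" using assms by simp
  have "(\<Sum>i = u + 1..d. ln (real i)) \<le> (\<Sum>i = u + 1..d. ln (real d))"
    by (intro sum_mono) auto
  then have "(\<Sum>i = u + 1..d. ln (real i)) / real (d - u) \<le> ln (real d)"
    using assms by (simp add: divide_le_eq mult.commute)
  moreover have "1 / 2 \<le> sqrt (real u / real d)"
    using False d by (intro real_le_rsqrt) (simp add: field_simps power2_eq_square)
  moreover define E where "E = 2 * (ln (real d) + 1) / real d"
  moreover have "E \<ge> 0" using d by (simp add: E_def)
  ultimately show ?thesis by simp
qed

text \<open>The square-free form of \<open>4 ^ m / sqrt (2 * m + 1)\<close> as a bound for the
  central coefficient. The induction step amounts to
  \<open>(2 * m + 1) * (2 * m + 3) \<le> 4 * (m + 1)\<^sup>2\<close>.\<close>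

lemma central_binomial_sq: "((2 * m) choose m)\<^sup>2 * (2 * m + 1) \<le> 16 ^ m"
proof (induction m)
  case (Suc m)
  let ?c = "(2 * m) choose m" and ?C = "(2 * Suc m) choose Suc m"
  have "Suc m * ?C = 2 * ((2 * m + 1) * ?c)"
  proof -
    have "Suc m * ?C = 2 * Suc m * ((2 * m + 1) choose m)"
      using Suc_times_binomial_eq[of "2 * m + 1" m] by simp
    also have "Suc m * ((2 * m + 1) choose m) = (2 * m + 1) * ?c"
    proof -
      have "(2 * m + 1) choose m = (2 * m + 1) choose Suc m"
        using binomial_symmetric[of m "2 * m + 1"] by simp
      then show ?thesis using Suc_times_binomial_eq[of "2 * m" m] by (simp add: mult.commute)
    qed
    then have "2 * Suc m * ((2 * m + 1) choose m) = 2 * ((2 * m + 1) * ?c)" by (simp only: mult.assoc)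
    finally show ?thesis .
  qed
  then have "(Suc m)\<^sup>2 * (?C\<^sup>2 * (2 * Suc m + 1)) = 4 * ((2 * m + 1) * (2 * m + 3)) * (?c\<^sup>2 * (2 * m + 1))"
    by (simp add: power2_eq_square) algebra
  also have "\<dots> \<le> 4 * (4 * (Suc m)\<^sup>2) * 16 ^ m"
  proof (rule mult_le_mono)
    show "4 * ((2 * m + 1) * (2 * m + 3)) \<le> 4 * (4 * (Suc m)\<^sup>2)"
      by (simp add: power2_eq_square algebra_simps)
  qed (rule Suc.IH)
  also have "\<dots> = (Suc m)\<^sup>2 * 16 ^ Suc m" by simp
  finally show ?case by simp
qed simp

lemma middle_binomial_le:
  assumes "n > 0"
  shows "real (n choose (n div 2)) \<le> 2 ^ n / sqrt (real n)"
proof -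
  have even: "real ((2 * m) choose m) * sqrt (real (2 * m + 1)) \<le> 4 ^ m" for m
  proof (rule power2_le_imp_le)
    have "real (((2 * m) choose m)\<^sup>2 * (2 * m + 1)) \<le> real (16 ^ m)"
      using central_binomial_sq[of m] by (simp only: of_nat_le_iff)
    moreover have "(4 ^ m)\<^sup>2 = (16 :: real) ^ m"
      by (simp add: power2_eq_square flip: power_mult_distrib)
    ultimately show "(real ((2 * m) choose m) * sqrt (real (2 * m + 1)))\<^sup>2 \<le> (4 ^ m)\<^sup>2"
      by (simp only: power_mult_distrib real_sqrt_pow2 of_nat_0_le_iff of_nat_mult of_nat_power of_nat_numeral)
  qed simp
  have "real (n choose (n div 2)) * sqrt (real n) \<le> 2 ^ n"
  proof (cases "even n")
    case True
    then obtain m where m: "n = 2 * m" by blast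
    have "real (n choose (n div 2)) * sqrt (real n) \<le> real ((2 * m) choose m) * sqrt (real (2 * m + 1))"
      unfolding m by (intro mult_mono) auto
    also have "\<dots> \<le> 4 ^ m" by (rule even)
    finally show ?thesis by (simp add: m power_mult)
  next
    case False
    then obtain m where m: "n = 2 * m + 1" using oddE by blast
    \<comment> \<open>A middle coefficient of an odd row is half the central coefficient of the next
      even row.\<close>
    have "(2 * m + 1) choose m = (2 * m + 1) choose Suc m"
      using binomial_symmetric[of m "2 * m + 1"] by simp
    then have "(2 * Suc m) choose Suc m = 2 * ((2 * m + 1) choose m)" by simp
    then have "2 * real (n choose (n div 2)) = real ((2 * Suc m) choose Suc m)" by (simp add: m)
    then have "2 * real (n choose (n div 2)) * sqrt (real n) \<le> real ((2 * Suc m) choose Suc m) * sqrt (real (2 * Suc m + 1))"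
      by (intro mult_mono) (auto simp: m)
    also have "\<dots> \<le> 4 ^ Suc m" by (rule even)
    finally show ?thesis by (simp add: m power_mult)
  qed
  then show ?thesis using assms by (simp add: field_simps)
qed

text \<open>The sum telescopes: since
  \<open>(k + 1) * (n choose (k + 1)) = (n - k) * (n choose k)\<close>, each term is the increment
  of \<open>k * (n choose k)\<close>.\<close>

lemma sum_level_deviation:
  "m \<le> n \<Longrightarrow> (\<Sum>k<m. (real n - 2 * real k) * real (n choose k)) = real m * real (n choose m)"
proof (induction m)
  case (Suc m)
  have "Suc m * (n choose Suc m) = (n - m) * (n choose m)"
    using Suc.prems binomial_absorb_comp[of n m] binomial_absorption[of m "n"]
    by (metis Suc_diff_Suc Suc_le_lessD binomial_absorption diff_Suc_1 times_binomial_minus1_eq zero_less_Suc)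
  then have "real (Suc m * (n choose Suc m)) = (real n - real m) * real (n choose m)"
    using Suc.prems by (simp only: of_nat_mult of_nat_diff Suc_leD)
  then show ?case using Suc by (simp add: algebra_simps)
qed simp

lemma sum_by_card:
  fixes F :: "nat \<Rightarrow> real"
  assumes "finite K"
  shows "(\<Sum>a | a \<subseteq> {1..n} \<and> card a \<in> K. F (card a)) = (\<Sum>k\<in>K. real (n choose k) * F k)"
proof -
  have "(\<Sum>a | a \<subseteq> {1..n} \<and> card a \<in> K. F (card a)) =
        (\<Sum>k\<in>K. \<Sum>a | a \<in> {a. a \<subseteq> {1..n} \<and> card a \<in> K} \<and> card a = k. F (card a))"
    using assms by (intro sum.group[symmetric]) auto
  also have "\<dots> = (\<Sum>k\<in>K. real (n choose k) * F k)"
  proof (rule sum.cong[OF refl])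
    fix k assume "k \<in> K"
    then have "{a. a \<in> {a. a \<subseteq> {1..n} \<and> card a \<in> K} \<and> card a = k} = {a. a \<subseteq> {1..n} \<and> card a = k}"
      by auto
    moreover have "card {a. a \<subseteq> {1..n} \<and> card a = k} = n choose k" using n_subsets[of "{1..n}" k] by simp
    ultimately show "(\<Sum>a | a \<in> {a. a \<subseteq> {1..n} \<and> card a \<in> K} \<and> card a = k. F (card a)) = real (n choose k) * F k"
      by simp
  qed
  finally show ?thesis .
qed

text \<open>A set of size at most \<open>(n + 1) / 2\<close> missed by \<open>f\<close> is a lost candidate for each of its at most
  \<open>(n + 1) / 2\<close> lower neighbours, and at most \<open>n choose (n div 2)\<close> such sets are missed.\<close>

lemma sum_missed_up_nbrs_le:
  assumes f: "f \<in> sdr (up_nbrs n) (lower_half n)"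
  shows "2 * (\<Sum>a\<in>lower_half n. card (up_nbrs n a - f ` lower_half n)) \<le> (n + 1) * (n choose (n div 2))"
proof -
  let ?A = "lower_half n"
  define B where "B = {b \<in> Pow {1..n}. 2 * card b \<le> n + 1}"
  have finB: "finite B" by (simp add: B_def)
  have fA: "f ` ?A \<subseteq> B" "card (f ` ?A) = card ?A"
    using f by (auto simp: sdr_def B_def up_nbrs_def lower_half_def card_image PiE_def Pi_def)
  \<comment> \<open>Injectivity gives the image of \<open>f\<close> the same size as
    \<open>?A\<close>, so as many sets of \<open>B\<close> are missed as there are in
    \<open>B - ?A\<close>, which is a single middle level.\<close>
  have "card (B - f ` ?A) = card B - card ?A" using fA finB by (metis card_Diff_subset finite_subset)
  also have "\<dots> = card (B - ?A)"
    by (subst card_Diff_subset) (auto simp: B_def lower_half_def)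
  also have "B - ?A = {b. b \<subseteq> {1..n} \<and> card b = (n + 1) div 2}"
    by (auto simp: B_def lower_half_def)
  also have "card \<dots> = n choose ((n + 1) div 2)" using n_subsets[of "{1..n}"] by simp
  also have "\<dots> = n choose (n - (n + 1) div 2)" by (rule binomial_symmetric) simp
  also have "n - (n + 1) div 2 = n div 2" by linarith
  finally have missed: "card (B - f ` ?A) = n choose (n div 2)" .
  have "(\<Sum>a\<in>?A. card (up_nbrs n a - f ` ?A)) = card (SIGMA a:?A. up_nbrs n a - f ` ?A)"
    by simp
  also have "\<dots> \<le> card (SIGMA b:B - f ` ?A. (\<lambda>i. b - {i}) ` b)"
  proof (rule card_inj_on_le[where f = "\<lambda>(a, b). (b, a)"])
    have "b \<in> B \<and> a \<in> (\<lambda>i. b - {i}) ` b" if a: "a \<in> ?A" and b: "b \<in> up_nbrs n a" for a b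
    proof -
      have fin: "finite a" "finite b" using a b finite_subset by (auto simp: lower_half_def up_nbrs_def)
      have "card (b - a) = 1" using fin b by (auto simp: up_nbrs_def card_Diff_subset)
      then obtain i where i: "b - a = {i}" by (auto simp: card_1_singleton_iff)
      then have "a = b - {i}" "i \<in> b" using b by (auto simp: up_nbrs_def)
      moreover have "b \<in> B" using a b by (auto simp: lower_half_def up_nbrs_def B_def)
      ultimately show ?thesis by blast
    qed
    then show "(\<lambda>(a, b). (b, a)) ` (SIGMA a:?A. up_nbrs n a - f ` ?A) \<subseteq> (SIGMA b:B - f ` ?A. (\<lambda>i. b - {i}) ` b)"
      by auto
    have "finite b" if "b \<in> B" for b using that by (auto simp: B_def intro: finite_subset)
    then show "finite (SIGMA b:B - f ` ?A. (\<lambda>i. b - {i}) ` b)" using finB by (intro finite_SigmaI) auto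
  qed (auto intro: inj_onI)
  also have "\<dots> = (\<Sum>b\<in>B - f ` ?A. card ((\<lambda>i. b - {i}) ` b))"
  proof (rule card_SigmaI)
    have "finite b" if "b \<in> B" for b using that by (auto simp: B_def intro: finite_subset)
    then show "\<forall>b\<in>B - f ` ?A. finite ((\<lambda>i. b - {i}) ` b)" by auto
  qed (use finB in simp)
  finally have "2 * (\<Sum>a\<in>?A. card (up_nbrs n a - f ` ?A)) \<le> (\<Sum>b\<in>B - f ` ?A. 2 * card ((\<lambda>i. b - {i}) ` b))"
    by (simp add: sum_distrib_left[symmetric])
  also have "\<dots> \<le> (\<Sum>b\<in>B - f ` ?A. n + 1)"
  proof (rule sum_mono)
    fix b assume b: "b \<in> B - f ` ?A"
    then have "finite b" by (auto simp: B_def intro: finite_subset)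
    then have "card ((\<lambda>i. b - {i}) ` b) \<le> card b" by (rule card_image_le)
    then show "2 * card ((\<lambda>i. b - {i}) ` b) \<le> n + 1" using b by (auto simp: B_def)
  qed
  also have "\<dots> = (n + 1) * (n choose (n div 2))" by (simp add: missed)
  finally show ?thesis .
qed

lemma card_up_nbrs:
  assumes "a \<subseteq> {1..n}"
  shows "card (up_nbrs n a) = n - card a"
proof -
  have fin: "finite a" using assms finite_subset by auto
  have "up_nbrs n a = (\<lambda>i. insert i a) ` ({1..n} - a)"
  proof (intro equalityI subsetI)
    fix b assume b: "b \<in> up_nbrs n a"
    then have "card (b - a) = 1" using fin by (auto simp: up_nbrs_def card_Diff_subset)
    then obtain i where i: "b - a = {i}" by (auto simp: card_1_singleton_iff)
    then have "b = insert i a" "i \<in> {1..n} - a" using b by (auto simp: up_nbrs_def)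
    then show "b \<in> (\<lambda>i. insert i a) ` ({1..n} - a)" by blast
  qed (use assms fin in \<open>auto simp: up_nbrs_def\<close>)
  moreover have "inj_on (\<lambda>i. insert i a) ({1..n} - a)" by (rule inj_onI) blast
  ultimately show ?thesis using assms fin by (simp add: card_image card_Diff_subset)
qed

lemma two_card_lower_half_le: "2 * card (lower_half n) \<le> 2 ^ n"
proof -
  let ?c = "\<lambda>a. {1..n} - a"
  have inj: "inj_on ?c (lower_half n)" by (rule inj_onI) (auto simp: lower_half_def)
  have "card (?c a) = n - card a" if "a \<in> lower_half n" for a
    using that by (auto simp: lower_half_def card_Diff_subset finite_subset)
  then have disj: "lower_half n \<inter> ?c ` lower_half n = {}"
    by (fastforce simp: lower_half_def)
  have "2 * card (lower_half n) = card (lower_half n \<union> ?c ` lower_half n)"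
    using disj inj by (subst card_Un_disjoint) (auto simp: card_image)
  also have "\<dots> \<le> card (Pow {1..n})"
    by (rule card_mono) (auto simp: lower_half_def)
  finally show ?thesis by (simp add: card_Pow)
qed

text \<open>A set \<open>a\<close> has \<open>n - card a\<close> upper neighbours, which is
  \<open>n / 2\<close> times \<open>1 + (n - 2 * card a) / n\<close>. The logarithms of these
  correction factors are bounded by the terms summed here.\<close>

lemma sum_deviation_lower_half:
  "(\<Sum>a\<in>lower_half n. (real n - 2 * real (card a)) / real n) \<le> real (n choose (n div 2))"
proof -
  define m where "m = (n + 1) div 2"
  have m: "m \<le> n" by (simp add: m_def)
  have "lower_half n = {a. a \<subseteq> {1..n} \<and> card a \<in> {..<m}}"
    by (auto simp: lower_half_def m_def)
  then have "(\<Sum>a\<in>lower_half n. (real n - 2 * real (card a)) / real n) =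
      (\<Sum>k<m. real (n choose k) * ((real n - 2 * real k) / real n))"
    using sum_by_card[of "{..<m}" "\<lambda>k. (real n - 2 * real k) / real n" n] by simp
  also have "\<dots> = (\<Sum>k<m. (real n - 2 * real k) * real (n choose k)) / real n"
    by (simp add: sum_divide_distrib mult.commute)
  also have "\<dots> = real m * real (n choose m) / real n" by (simp only: sum_level_deviation[OF m])
  also have "\<dots> \<le> real (n choose m)"
    using m by (cases "n = 0") (auto simp: divide_le_eq mult.commute intro!: mult_left_mono)
  also have "n choose m = n choose (n div 2)"
  proof -
    have "n - m = n div 2" unfolding m_def by linarith
    then show ?thesis using binomial_symmetric[OF m] by simp
  qed
  finally show ?thesis .
qed

text \<open>AM-GM with a free parameter makes the square root linear, because only the total number
  of missed candidates is under control.\<close>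

lemma two_sqrt_le:
  assumes "x \<ge> 0" "\<delta> > 0"
  shows "2 * sqrt x \<le> \<delta> + x / \<delta>"
proof -
  have "0 \<le> (sqrt x - \<delta>)\<^sup>2" by simp
  also have "\<dots> = x - 2 * sqrt x * \<delta> + \<delta>\<^sup>2" using assms by (simp add: power2_diff)
  finally show ?thesis using assms by (simp add: field_simps power2_eq_square)
qed

text \<open>In the exponent, \<open>M\<close> pays for degrees above \<open>n / 2\<close> and
  \<open>2 * M / \<delta>\<close> for the missed candidates. The parameter \<open>\<delta>\<close>
  stays free to balance the latter against the cost \<open>\<delta>\<close> per set.\<close>

lemma card_sdr_up_nbrs_le:
  assumes n: "n > 0" and \<delta>: "\<delta> > 0" and big: "real n \<ge> 2 * exp 1"
  defines "M \<equiv> real (n choose (n div 2))"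
  shows "real (card (sdr (up_nbrs n) (lower_half n))) \<le>
    exp (2 ^ n / 2 * (ln (real n / 2) - 1 + \<delta> + 4 * (ln (real n) + 1) / real n) + M + 2 * M / \<delta>)"
proof (rule card_sdr_le)
  fix f assume f: "f \<in> sdr (up_nbrs n) (lower_half n)"
  let ?A = "lower_half n"
  let ?u = "\<lambda>a. card (up_nbrs n a - f ` ?A)"
  define K where "K = ln (real n / 2) - 1 + \<delta> + 4 * (ln (real n) + 1) / real n"
  have lnn: "ln (real n) \<ge> 0" using n by simp
  \<comment> \<open>The hypothesis \<open>big\<close> makes \<open>K\<close> nonnegative, so that
    \<open>card ?A\<close> can be replaced by its upper bound \<open>2 ^ n / 2\<close>.\<close>
  have "ln (real n / 2) \<ge> 1" using big n by (subst ln_ge_iff) auto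
  then have K: "K \<ge> 0" using \<delta> lnn n by (simp add: K_def)
  have term_le: "(\<Sum>i = ?u a + 1..card (up_nbrs n a). ln (real i)) / real (card (up_nbrs n a) - ?u a)
      \<le> K + (real n - 2 * real (card a)) / real n + 2 * real (?u a) / real n / \<delta>" if a: "a \<in> ?A" for a
  proof -
    have a': "a \<subseteq> {1..n}" "2 * card a < n" using a by (auto simp: lower_half_def)
    define d where "d = card (up_nbrs n a)"
    have d: "d = n - card a" using card_up_nbrs[OF a'(1)] by (simp add: d_def)
    have rd: "real d = real n - real (card a)" using a'(2) by (simp add: d of_nat_diff)
    then have d2: "real n / 2 \<le> real d" "real d \<le> real n" "real d > 0" using a'(2) by linarith+
    have "f a \<in> up_nbrs n a" using f a by (auto simp: sdr_def)
    then have "?u a < d" unfolding d_def using a by (intro psubset_card_mono) auto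
    then have "(\<Sum>i = ?u a + 1..d. ln (real i)) / real (d - ?u a) \<le>
       ln (real d) - 1 + 2 * sqrt (real (?u a) / real d) + 2 * (ln (real d) + 1) / real d"
      by (rule avg_ln_le)
    moreover have "2 * sqrt (real (?u a) / real d) \<le> \<delta> + 2 * real (?u a) / real n / \<delta>"
    proof -
      have "2 * sqrt (real (?u a) / real d) \<le> \<delta> + real (?u a) / real d / \<delta>"
        using \<delta> by (intro two_sqrt_le) auto
      also have "real (?u a) / real d \<le> real (?u a) / (real n / 2)"
        using d2 n by (intro divide_left_mono) auto
      finally show ?thesis using \<delta> by (simp add: divide_right_mono mult.commute)
    qed
    moreover have "2 * (ln (real d) + 1) / real d \<le> 4 * (ln (real n) + 1) / real n"
    proof -
      have "2 * (ln (real d) + 1) / real d \<le> 2 * (ln (real n) + 1) / (real n / 2)"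
        using d2 n lnn by (intro frac_le) auto
      then show ?thesis by simp
    qed
    moreover have "ln (real d) \<le> ln (real n / 2) + (real n - 2 * real (card a)) / real n"
    proof -
      have "real d = real n / 2 * (1 + (real n - 2 * real (card a)) / real n)"
        using n by (simp add: rd field_simps)
      moreover have pos: "(real n - 2 * real (card a)) / real n > 0" using a' n by simp
      ultimately have "ln (real d) = ln (real n / 2) + ln (1 + (real n - 2 * real (card a)) / real n)"
        using n by (simp only: ln_mult_pos)
      then show ?thesis using ln_add_one_self_le_self[of "(real n - 2 * real (card a)) / real n"] pos by simp
    qed
    moreover have "S \<le> l' - 1 + \<delta> + e' + t + v"
      if "S \<le> l - 1 + s + e" "s \<le> \<delta> + v" "e \<le> e'" "l \<le> l' + t" for S l s e v e' l' t :: real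
      using that by linarith
    ultimately show ?thesis unfolding d_def[symmetric] K_def by blast
  qed
  have "(\<Sum>a\<in>?A. (\<Sum>i = ?u a + 1..card (up_nbrs n a). ln (real i)) / real (card (up_nbrs n a) - ?u a))
      \<le> (\<Sum>a\<in>?A. K + (real n - 2 * real (card a)) / real n + 2 * real (?u a) / real n / \<delta>)"
    by (rule sum_mono) (rule term_le)
  also have "\<dots> = real (card ?A) * K + (\<Sum>a\<in>?A. (real n - 2 * real (card a)) / real n)
      + real (2 * (\<Sum>a\<in>?A. ?u a)) / real n / \<delta>"
    by (simp add: sum.distrib sum_divide_distrib sum_distrib_left)
  also have "real (card ?A) * K \<le> 2 ^ n / 2 * K"
  proof (rule mult_right_mono)
    have "real (2 * card ?A) \<le> real (2 ^ n)" using two_card_lower_half_le by (simp only: of_nat_le_iff)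
    then show "real (card ?A) \<le> 2 ^ n / 2" by simp
  qed (rule K)
  also have "(\<Sum>a\<in>?A. (real n - 2 * real (card a)) / real n) \<le> M"
    unfolding M_def by (rule sum_deviation_lower_half)
  also have "real (2 * (\<Sum>a\<in>?A. ?u a)) / real n / \<delta> \<le> 2 * M / \<delta>"
  proof -
    have "real (2 * (\<Sum>a\<in>?A. ?u a)) \<le> real ((n + 1) * (n choose (n div 2)))"
      using sum_missed_up_nbrs_le[OF f] by (simp only: of_nat_le_iff)
    also have "\<dots> \<le> 2 * real n * M" using n by (simp add: M_def mult_right_mono)
    finally have "real (2 * (\<Sum>a\<in>?A. ?u a)) / real n \<le> 2 * M" using n by (simp add: divide_le_eq mult_ac)
    then show ?thesis using \<delta> by (intro divide_right_mono) auto
  qed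
  finally show "(\<Sum>a\<in>?A. (\<Sum>i = ?u a + 1..card (up_nbrs n a). ln (real i)) / real (card (up_nbrs n a) - ?u a))
      \<le> 2 ^ n / 2 * (ln (real n / 2) - 1 + \<delta> + 4 * (ln (real n) + 1) / real n) + M + 2 * M / \<delta>"
    by (simp add: K_def)
qed auto

section \<open>Extending a decomposition by two levels\<close>

definition level :: "nat \<Rightarrow> nat \<Rightarrow> nat set set" where
  "level n i = {x. x \<subseteq> {1..n} \<and> card x = i}"

definition band :: "nat \<Rightarrow> nat \<Rightarrow> nat set set" where
  "band n k = {x. x \<subseteq> {1..n} \<and> k \<le> card x \<and> card x \<le> n - k}"

text \<open>The starting level \<open>j\<close> of a chain may vary; \<open>k \<le> j\<close> holds
  because the lowest set of the chain belongs to the band.\<close>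

definition band_scd :: "nat \<Rightarrow> nat \<Rightarrow> nat set set set \<Rightarrow> bool" where
  "band_scd n k D \<longleftrightarrow> partition_on (band n k) D \<and> (\<forall>c\<in>D. \<exists>j. levelled n j c)"

lemma finite_level [simp]: "finite (level n i)"
  by (rule finite_subset[of _ "Pow {1..n}"]) (auto simp: level_def)

lemma finite_band [simp]: "finite (band n i)"
  by (rule finite_subset[of _ "Pow {1..n}"]) (auto simp: band_def)

lemma card_level [simp]: "card (level n i) = n choose i"
  using n_subsets[of "{1..n}" i] by (simp add: level_def)

lemma finite_band_scd [simp]: "finite {D. band_scd n k D}"
proof (rule finite_subset)
  show "{D. band_scd n k D} \<subseteq> Pow (Pow (band n k))"
    by (auto simp: band_scd_def dest: partition_onD1)
qed simp

lemma card_band_scd_0: "card {D. band_scd n 0 D} = num_scd n"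
proof -
  have "band n 0 = Pow {1..n}" using card_mono[of "{1..n}"] by (auto simp: band_def)
  then show ?thesis
    by (simp add: num_scd_def band_scd_def symmetric_chain_decomposition_def symmetric_chain_iff)
qed

lemma card_up_level:
  assumes "x \<in> level n i"
  shows "card {y \<in> level n (Suc i). x \<subset> y} = n - i"
proof -
  have "{y \<in> level n (Suc i). x \<subset> y} = up_nbrs n x"
    using assms by (auto simp: up_nbrs_def level_def)
  then show ?thesis using assms card_up_nbrs[of x n] by (auto simp: level_def)
qed

lemma card_down_level:
  assumes "y \<in> level n (Suc i)"
  shows "card {x \<in> level n i. x \<subset> y} = Suc i"
proof -
  have y: "finite y" "card y = Suc i" "y \<subseteq> {1..n}"
    using assms finite_subset by (auto simp: level_def)
  have "{x \<in> level n i. x \<subset> y} = {x. x \<subseteq> y \<and> card x = i}"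
    using y by (auto simp: level_def)
  then show ?thesis using n_subsets[OF y(1), of i] y(2) by simp
qed

context
  fixes n k :: nat and D :: "nat set set set"
  assumes kn: "2 * Suc k \<le> n" and D: "band_scd n (Suc k) D"
begin

definition same_chain :: "nat set \<Rightarrow> nat set \<Rightarrow> bool" where
  "same_chain x y \<longleftrightarrow> (\<exists>c\<in>D. x \<in> c \<and> y \<in> c)"

text \<open>A chain of \<open>D\<close> running from \<open>y\<close> on level \<open>k + 1\<close> to \<open>x\<close> on level \<open>n - k - 1\<close> stays as it is
  when \<open>f x = y\<close>; otherwise it is prolonged by the preimage of \<open>y\<close> and by \<open>f x\<close>.\<close>

definition ext_edge :: "nat set \<Rightarrow> nat set \<Rightarrow> bool" where
  "ext_edge x y \<longleftrightarrow>
     x \<in> level n k \<and> y \<in> level n (Suc k) \<and> x \<subset> y \<or>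
     x \<in> level n (n - Suc k) \<and> y \<in> level n (n - k) \<and> x \<subset> y \<or>
     x \<in> level n (n - Suc k) \<and> y \<in> level n (Suc k) \<and> same_chain x y"

definition ext_matchings :: "(nat set \<Rightarrow> nat set) set" where
  "ext_matchings = {f \<in> bijs (level n k \<union> level n (n - Suc k)) (level n (Suc k) \<union> level n (n - k)).
     \<forall>x\<in>level n k \<union> level n (n - Suc k). ext_edge x (f x)}"

text \<open>One formula covers all cases: a chain not reaching the extreme levels of the band gains
  nothing, and if its top is matched to its own bottom, both added families are empty.\<close>

definition extend :: "(nat set \<Rightarrow> nat set) \<Rightarrow> nat set set \<Rightarrow> nat set set" where
  "extend f c = c \<union> {a \<in> level n k. f a \<in> c} \<union> {b \<in> level n (n - k). \<exists>z\<in>c \<inter> level n (n - Suc k). b = f z}"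

lemma Suc_k_le: "Suc k \<le> n - Suc k"
  using kn by simp

lemma D_partition: "partition_on (band n (Suc k)) D"
  using D by (simp add: band_scd_def)

lemma D_levelled:
  assumes "c \<in> D"
  obtains j where "levelled n j c" "Suc k \<le> j"
proof -
  obtain j where j: "levelled n j c" using D assms by (auto simp: band_scd_def)
  then have "j \<le> n - j" by (auto simp: levelled_def)
  then obtain x where "x \<in> c" "card x = j" using levelled_ex[OF j, of j] by auto
  moreover have "x \<in> band n (Suc k)" using partition_onD1[OF D_partition] assms \<open>x \<in> c\<close> by blast
  ultimately show ?thesis using that j by (auto simp: band_def)
qed

lemma D_unique: "c \<in> D \<Longrightarrow> x \<in> c \<Longrightarrow> y \<in> c \<Longrightarrow> card x = card y \<Longrightarrow> x = y"
  using D_levelled levelled_unique by metis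

lemma D_same: "c \<in> D \<Longrightarrow> c' \<in> D \<Longrightarrow> x \<in> c \<Longrightarrow> x \<in> c' \<Longrightarrow> c = c'"
  using partition_on_same_part[OF D_partition] by blast

lemma D_subset: "c \<in> D \<Longrightarrow> c \<subseteq> band n (Suc k)"
  using partition_onD1[OF D_partition] by blast

lemma D_ex: "x \<in> band n (Suc k) \<Longrightarrow> \<exists>c\<in>D. x \<in> c"
  using partition_onD1[OF D_partition] by blast

lemma levels_in_band:
  "level n (Suc k) \<subseteq> band n (Suc k)" "level n (n - Suc k) \<subseteq> band n (Suc k)"
  using kn by (auto simp: level_def band_def)

lemma levels_notin_band:
  "x \<in> level n k \<Longrightarrow> x \<notin> band n (Suc k)" "x \<in> level n (n - k) \<Longrightarrow> x \<notin> band n (Suc k)"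
  using kn by (auto simp: level_def band_def)

text \<open>Levels \<open>k + 1\<close> and \<open>n - k - 1\<close> are left out on purpose: they
  coincide when \<open>n = 2 * k + 2\<close>. Each of their sets then occurs on both sides of the
  bipartite graph, with its singleton chain as an edge between the two copies.\<close>

lemma levels_disjoint:
  "level n k \<inter> level n (n - Suc k) = {}" "level n (Suc k) \<inter> level n (n - k) = {}"
  "level n k \<inter> level n (n - k) = {}" "level n k \<inter> level n (Suc k) = {}"
  "level n (n - Suc k) \<inter> level n (n - k) = {}"
  using kn by (auto simp: level_def)

text \<open>A chain that reaches level \<open>n - k - 1\<close> starts at level \<open>k + 1\<close>
  by symmetry, and it has only one set there.\<close>

lemma ex1_same_chain:
  assumes "x \<in> level n (n - Suc k)"
  shows "card {y \<in> level n (Suc k). same_chain x y} = 1"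
proof -
  obtain c where c: "c \<in> D" "x \<in> c" using D_ex assms levels_in_band by blast
  obtain j where j: "levelled n j c" "Suc k \<le> j" using D_levelled[OF c(1)] by blast
  have "j = Suc k" using levelled_card(2)[OF j(1) c(2)] j assms by (auto simp: level_def levelled_def)
  then obtain y where y: "y \<in> c" "card y = Suc k" using levelled_ex[OF j(1), of "Suc k"] Suc_k_le by auto
  have "{y \<in> level n (Suc k). same_chain x y} = {y}"
  proof (intro equalityI subsetI)
    fix y' assume "y' \<in> {y \<in> level n (Suc k). same_chain x y}"
    then obtain c' where c': "c' \<in> D" "x \<in> c'" "y' \<in> c'" "card y' = Suc k"
      by (auto simp: same_chain_def level_def)
    then have "c' = c" using D_same c by blast
    then show "y' \<in> {y}" using D_unique[OF c(1), of y' y] c' y by simp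
  next
    fix y' assume "y' \<in> {y}"
    then show "y' \<in> {y \<in> level n (Suc k). same_chain x y}"
      using y c levelled_card(3)[OF j(1)] by (auto simp: same_chain_def level_def)
  qed
  then show ?thesis by simp
qed

lemma ex1_same_chain':
  assumes "y \<in> level n (Suc k)"
  shows "card {x \<in> level n (n - Suc k). same_chain x y} = 1"
proof -
  obtain c where c: "c \<in> D" "y \<in> c" using D_ex assms levels_in_band by blast
  obtain j where j: "levelled n j c" "Suc k \<le> j" using D_levelled[OF c(1)] by blast
  have "j = Suc k" using levelled_card(1)[OF j(1) c(2)] j assms by (auto simp: level_def)
  then obtain x where x: "x \<in> c" "card x = n - Suc k" using levelled_ex[OF j(1), of "n - Suc k"] Suc_k_le by auto
  have "{x \<in> level n (n - Suc k). same_chain x y} = {x}"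
  proof (intro equalityI subsetI)
    fix x' assume "x' \<in> {x \<in> level n (n - Suc k). same_chain x y}"
    then obtain c' where c': "c' \<in> D" "y \<in> c'" "x' \<in> c'" "card x' = n - Suc k"
      by (auto simp: same_chain_def level_def)
    then have "c' = c" using D_same c by blast
    then show "x' \<in> {x}" using D_unique[OF c(1), of x' x] c' x by simp
  next
    fix x' assume "x' \<in> {x}"
    then show "x' \<in> {x \<in> level n (n - Suc k). same_chain x y}"
      using x c levelled_card(3)[OF j(1)] by (auto simp: same_chain_def level_def)
  qed
  then show ?thesis by simp
qed

text \<open>The weights \<open>1 / (n - k)\<close> on inclusions and \<open>(n - 2 * k - 1) / (n - k)\<close> on chains are doubly
  stochastic.\<close>

lemma card_ext_matchings_ge:
  "real (card ext_matchings) \<ge>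
     exp (- (real (n choose k) + real (n choose Suc k))) * (real n - real k) ^ (2 * (n choose k))"
proof -
  let ?X = "level n k \<union> level n (n - Suc k)" and ?Y = "level n (Suc k) \<union> level n (n - k)"
  define p where "p = 1 / (real n - real k)"
  define r where "r = (real n - 2 * real k - 1) / (real n - real k)"
  define w where "w = (\<lambda>x y. if x \<in> level n k \<and> y \<in> level n (Suc k) \<and> x \<subset> y \<or>
       x \<in> level n (n - Suc k) \<and> y \<in> level n (n - k) \<and> x \<subset> y then p
     else if x \<in> level n (n - Suc k) \<and> y \<in> level n (Suc k) \<and> same_chain x y then r else 0)"
  have "real (2 * Suc k) \<le> real n" using kn by (simp only: of_nat_le_iff)
  then have nk: "real n - real k > 0" "real n - 2 * real k - 1 > 0" by simp_all
  have p: "p > 0" and r: "r \<ge> 0" "r \<le> 1" using nk by (auto simp: p_def r_def divide_le_eq)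
  have pr: "real (n - k) * p = 1" "(real n - real k) * p = 1" "real (Suc k) * p + r = 1"
    using nk kn by (simp_all add: p_def r_def of_nat_diff flip: add_divide_distrib)
  have Suc_eq: "Suc (n - Suc k) = n - k" using kn by simp
  have choose_eq: "n choose (n - Suc k) = n choose (Suc k)" "n choose (n - k) = n choose k"
    using kn binomial_symmetric[of "Suc k" n] binomial_symmetric[of k n] by simp_all
  have cX: "card ?X = (n choose k) + (n choose (Suc k))"
    using levels_disjoint by (simp add: card_Un_disjoint choose_eq)
  have cY: "card ?Y = (n choose k) + (n choose (Suc k))"
    using levels_disjoint by (simp add: card_Un_disjoint choose_eq)
  have count: "(\<Sum>y\<in>S. if P y then q else 0) = real (card {y \<in> S. P y}) * q" if "finite S" for S P and q :: real
    using that by (simp add: sum.If_cases Int_def)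
  have split_Y: "(\<Sum>y\<in>?Y. w x y) = (\<Sum>y\<in>level n (Suc k). w x y) + (\<Sum>y\<in>level n (n - k). w x y)" for x
    using levels_disjoint by (intro sum.union_disjoint) auto
  have split_X: "(\<Sum>x\<in>?X. w x y) = (\<Sum>x\<in>level n k. w x y) + (\<Sum>x\<in>level n (n - Suc k). w x y)" for y
    using levels_disjoint by (intro sum.union_disjoint) auto
  have w11: "w x y = (if x \<subset> y then p else 0)" if "x \<in> level n k" "y \<in> level n (Suc k)" for x y
    using that levels_disjoint by (auto simp: w_def)
  have w12: "w x y = 0" if "x \<in> level n k" "y \<in> level n (n - k)" for x y
    using that levels_disjoint by (auto simp: w_def)
  have w21: "w x y = (if same_chain x y then r else 0)" if "x \<in> level n (n - Suc k)" "y \<in> level n (Suc k)" for x y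
    using that levels_disjoint by (auto simp: w_def)
  have w22: "w x y = (if x \<subset> y then p else 0)" if "x \<in> level n (n - Suc k)" "y \<in> level n (n - k)" for x y
    using that levels_disjoint by (auto simp: w_def)
  have row: "(\<Sum>y\<in>?Y. w x y) = 1" if "x \<in> ?X" for x
    using that
  proof
    assume x: "x \<in> level n k"
    show ?thesis unfolding split_Y using card_up_level[OF x] pr
      by (simp add: w11[OF x] w12[OF x] count)
  next
    assume x: "x \<in> level n (n - Suc k)"
    have "card {y \<in> level n (n - k). x \<subset> y} = Suc k"
      using card_up_level[OF x] kn unfolding Suc_eq by simp
    then show ?thesis unfolding split_Y using ex1_same_chain[OF x] pr
      by (simp add: w21[OF x] w22[OF x] count add.commute)
  qed
  have col: "(\<Sum>x\<in>?X. w x y) = 1" if "y \<in> ?Y" for y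
    using that
  proof
    assume y: "y \<in> level n (Suc k)"
    show ?thesis unfolding split_X using card_down_level[OF y] ex1_same_chain'[OF y] pr
      by (simp add: w11[OF _ y] w21[OF _ y] count)
  next
    assume y: "y \<in> level n (n - k)"
    then have "card {x \<in> level n (n - Suc k). x \<subset> y} = n - k"
      using card_down_level[of y n "n - Suc k"] unfolding Suc_eq by simp
    then show ?thesis unfolding split_X using pr
      by (simp add: w12[OF _ y] w22[OF _ y] count)
  qed
  have "exp (- real (card ?X)) \<le> permanent w ?X ?Y"
    using cX cY row col p r
    by (intro permanent_doubly_stochastic_ge) (auto simp: w_def)
  also have "\<dots> = (\<Sum>f\<in>ext_matchings. \<Prod>x\<in>?X. w x (f x))"
    unfolding permanent_def
  proof (rule sum.mono_neutral_right)
    show "\<forall>f\<in>bijs ?X ?Y - ext_matchings. (\<Prod>x\<in>?X. w x (f x)) = 0"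
    proof
      fix f assume "f \<in> bijs ?X ?Y - ext_matchings"
      then obtain x where "x \<in> ?X" "\<not> ext_edge x (f x)" by (auto simp: ext_matchings_def)
      then have "x \<in> ?X" "w x (f x) = 0" by (auto simp: w_def ext_edge_def)
      then show "(\<Prod>x\<in>?X. w x (f x)) = 0" by (intro prod_zero) auto
    qed
  qed (auto simp: ext_matchings_def)
  also have "\<dots> \<le> (\<Sum>f\<in>ext_matchings. p ^ (2 * (n choose k)))"
  proof (rule sum_mono)
    fix f assume "f \<in> ext_matchings"
    then have bij: "bij_betw f ?X ?Y" by (auto simp: ext_matchings_def bijs_def)
    \<comment> \<open>Left vertices on level \<open>k\<close> and right vertices on level
      \<open>n - k\<close> lie on inclusion edges only, and no edge joins one to the other. So a
      matching has at least \<open>2 * (n choose k)\<close> factors \<open>p\<close>, and its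
      remaining factors are at most 1.\<close>
    let ?u = "\<lambda>x. if x \<in> level n k then p else 1" and ?v = "\<lambda>y. if y \<in> level n (n - k) then p else 1"
    have "(\<Prod>x\<in>?X. w x (f x)) \<le> (\<Prod>x\<in>?X. ?u x * ?v (f x))"
    proof (rule prod_mono, intro conjI)
      fix x assume "x \<in> ?X"
      then have fx: "f x \<in> ?Y" using bij by (auto simp: bij_betw_def)
      show "0 \<le> w x (f x)" using p r by (simp add: w_def)
      show "w x (f x) \<le> ?u x * ?v (f x)"
        using \<open>x \<in> ?X\<close> fx
      proof (elim UnE)
        assume "x \<in> level n k" "f x \<in> level n (Suc k)"
        then show ?thesis using w11 levels_disjoint p by auto
      next
        assume "x \<in> level n k" "f x \<in> level n (n - k)"
        then show ?thesis using w12 p by auto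
      next
        assume "x \<in> level n (n - Suc k)" "f x \<in> level n (Suc k)"
        then show ?thesis using w21 levels_disjoint r by auto
      next
        assume "x \<in> level n (n - Suc k)" "f x \<in> level n (n - k)"
        then show ?thesis using w22 levels_disjoint p by auto
      qed
    qed
    also have "\<dots> = (\<Prod>x\<in>?X. ?u x) * (\<Prod>y\<in>?Y. ?v y)"
      using prod.reindex_bij_betw[OF bij, of ?v] by (simp add: prod.distrib)
    also have "(\<Prod>x\<in>?X. ?u x) = p ^ (n choose k)"
      by (simp add: prod.If_cases Int_absorb1)
    also have "(\<Prod>y\<in>?Y. ?v y) = p ^ (n choose k)"
      by (simp add: prod.If_cases Int_absorb1 choose_eq)
    finally show "(\<Prod>x\<in>?X. w x (f x)) \<le> p ^ (2 * (n choose k))" by (simp add: mult_2 power_add)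
  qed
  also have "\<dots> = real (card ext_matchings) / (real n - real k) ^ (2 * (n choose k))"
    by (simp add: p_def power_one_over)
  finally show ?thesis using nk by (simp add: cX field_simps)
qed

section \<open>Prolonging the chains along a matching\<close>

context
  fixes f assumes f: "f \<in> ext_matchings"
begin

lemma matching_ext_edge: "x \<in> level n k \<union> level n (n - Suc k) \<Longrightarrow> ext_edge x (f x)"
  using f by (auto simp: ext_matchings_def)

lemma matching_lower:
  assumes "x \<in> level n k"
  shows "f x \<in> level n (Suc k)" "x \<subset> f x"
  using matching_ext_edge[of x] assms levels_disjoint by (auto simp: ext_edge_def)

lemma matching_upper:
  assumes "x \<in> level n (n - Suc k)"
  shows "f x \<in> level n (n - k) \<and> x \<subset> f x \<or> f x \<in> level n (Suc k) \<and> same_chain x (f x)"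
  using matching_ext_edge[of x] assms levels_disjoint by (auto simp: ext_edge_def)

lemma matching_inj:
  "x \<in> level n k \<union> level n (n - Suc k) \<Longrightarrow> y \<in> level n k \<union> level n (n - Suc k) \<Longrightarrow> f x = f y \<Longrightarrow> x = y"
  using f by (auto simp: ext_matchings_def bijs_def bij_betw_def inj_on_def)

lemma matching_surj:
  assumes "y \<in> level n (Suc k) \<union> level n (n - k)"
  obtains x where "x \<in> level n k \<union> level n (n - Suc k)" "f x = y"
proof -
  have "y \<in> f ` (level n k \<union> level n (n - Suc k))"
    using f assms by (auto simp: ext_matchings_def bijs_def bij_betw_def)
  then show ?thesis using that by blast
qed

lemma extend_Int_band: "c \<in> D \<Longrightarrow> extend f c \<inter> band n (Suc k) = c"
  using D_subset[of c] levels_notin_band by (auto simp: extend_def)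

text \<open>Only a chain from a bottom \<open>x\<close> on level \<open>k + 1\<close> to a top
  \<open>z\<close> on level \<open>n - k - 1\<close> can change, and it does not if
  \<open>f z = x\<close>. Otherwise \<open>f z\<close> is a new top; the preimage of
  \<open>x\<close> cannot be on level \<open>n - k - 1\<close>, where the only possible partner of
  \<open>x\<close> is \<open>z\<close>, so it is on level \<open>k\<close> and is a new
  bottom.\<close>

lemma levelled_extend:
  assumes c: "c \<in> D"
  shows "\<exists>j. levelled n j (extend f c)"
proof -
  obtain j where j: "levelled n j c" "Suc k \<le> j" using D_levelled[OF c] by blast
  show ?thesis
  proof (cases "extend f c = c")
    case True
    then show ?thesis using j by auto
  next
    case False
    have "j = Suc k"
    proof (rule ccontr)
      assume "j \<noteq> Suc k"
      then have *: "Suc k < card x \<and> card x < n - Suc k" if "x \<in> c" for x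
        using levelled_card[OF j(1) that] j kn by (auto simp: levelled_def)
      have "f a \<notin> c" if "a \<in> level n k" for a
        using matching_lower[OF that] *[of "f a"] by (auto simp: level_def)
      moreover have "z \<notin> level n (n - Suc k)" if "z \<in> c" for z
        using *[OF that] by (auto simp: level_def)
      ultimately have "extend f c = c" unfolding extend_def by blast
      then show False using False by simp
    qed
    then have j: "levelled n (Suc k) c" using j by simp
    obtain x where x: "x \<in> c" "card x = Suc k" using levelled_ex[OF j, of "Suc k"] Suc_k_le by auto
    obtain z where z: "z \<in> c" "card z = n - Suc k" using levelled_ex[OF j, of "n - Suc k"] Suc_k_le by auto
    have xl: "x \<in> level n (Suc k)" and zl: "z \<in> level n (n - Suc k)"
      using x z levelled_card(3)[OF j] by (auto simp: level_def)
    have z_unique: "z' = z" if "z' \<in> c" "z' \<in> level n (n - Suc k)" for z'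
      using D_unique[OF c that(1) z(1)] that z by (simp add: level_def)
    have x_unique: "x' = x" if "x' \<in> c" "x' \<in> level n (Suc k)" for x'
      using D_unique[OF c that(1) x(1)] that x by (simp add: level_def)
    have fz: "f z \<in> level n (n - k) \<and> z \<subset> f z"
    proof (rule ccontr)
      assume neg: "\<not> ?thesis"
      then have fz: "f z \<in> level n (Suc k)" "same_chain z (f z)" using matching_upper[OF zl] by auto
      then obtain c' where "c' \<in> D" "z \<in> c'" "f z \<in> c'" by (auto simp: same_chain_def)
      then have "f z \<in> c" using D_same[of c' c z] c z by blast
      then have "f z = x" using x_unique fz by blast
      have "f a \<notin> c" if a: "a \<in> level n k" for a
      proof
        assume "f a \<in> c"
        then have "f a = x" using x_unique matching_lower[OF a] by blast
        then have "a = z" using matching_inj[of a z] a zl \<open>f z = x\<close> by blast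
        then show False using a zl levels_disjoint by blast
      qed
      moreover have "f z' \<notin> level n (n - k)" if "z' \<in> c \<inter> level n (n - Suc k)" for z'
        using z_unique[of z'] that fz levels_disjoint by blast
      ultimately have "extend f c = c" unfolding extend_def by blast
      then show False using False by simp
    qed
    obtain a where a: "a \<in> level n k \<union> level n (n - Suc k)" "f a = x" using matching_surj xl by blast
    have al: "a \<in> level n k"
    proof (rule ccontr)
      assume "a \<notin> level n k"
      then have al: "a \<in> level n (n - Suc k)" using a by blast
      then have "same_chain a x" using matching_upper[OF al] a xl levels_disjoint by auto
      then obtain c' where "c' \<in> D" "a \<in> c'" "x \<in> c'" by (auto simp: same_chain_def)
      then have "a \<in> c" using D_same[of c' c x] c x by blast
      then have "f z = x" using z_unique[of a] al a by blast
      then show False using fz xl levels_disjoint by blast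
    qed
    have ax: "a \<subset> x" using matching_lower[OF al] a by simp
    have ext: "extend f c = insert a (insert (f z) c)"
    proof (intro equalityI subsetI)
      fix y assume "y \<in> extend f c"
      then consider "y \<in> c" | "y \<in> level n k" "f y \<in> c" | z' where "z' \<in> c \<inter> level n (n - Suc k)" "y = f z'"
        unfolding extend_def by blast
      then show "y \<in> insert a (insert (f z) c)"
      proof cases
        case 2
        then have "f y = x" using x_unique matching_lower by blast
        then have "y = a" using matching_inj[of y a] 2 al a by blast
        then show ?thesis by simp
      next
        case 3
        then show ?thesis using z_unique[of z'] by blast
      qed simp
    next
      fix y assume "y \<in> insert a (insert (f z) c)"
      then show "y \<in> extend f c" using a al x fz zl z unfolding extend_def by blast
    qed
    have "levelled n k (extend f c)"
      unfolding levelled_def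
    proof (intro conjI ballI impI)
      show "2 * k \<le> n" using kn by simp
      show "extend f c \<subseteq> Pow {1..n}"
        unfolding ext using al fz levelled_card(3)[OF j] by (auto simp: level_def)
      have ca: "card a = k" "card (f z) = n - k" using al fz by (auto simp: level_def)
      have cc: "inj_on card c" "card ` c = {Suc k..n - Suc k}"
        using j by (auto simp: levelled_def bij_betw_def)
      have notin: "k \<notin> card ` c" "n - k \<notin> card ` c" "k \<noteq> n - k" using kn by (auto simp: cc(2))
      have "card (f z) \<notin> card ` (c - {f z})" using notin(2) unfolding ca by blast
      moreover have "card a \<notin> card ` (insert (f z) c - {a})"
      proof
        assume "card a \<in> card ` (insert (f z) c - {a})"
        then obtain t where "t = f z \<or> t \<in> c" "card t = k" unfolding ca by force
        then show False using notin(1,3) ca(2) by blast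
      qed
      ultimately have "inj_on card (insert a (insert (f z) c))"
        using cc(1) by (simp only: inj_on_insert simp_thms)
      moreover have "insert k (insert (n - k) {Suc k..n - Suc k}) = {k..n - k}"
        using kn by auto
      then have "card ` insert a (insert (f z) c) = {k..n - k}" by (simp add: cc(2) ca)
      ultimately show "bij_betw card (extend f c) {k..n - k}" by (simp add: bij_betw_def ext)
      fix u v assume u: "u \<in> extend f c" and v: "v \<in> extend f c" and uv: "card v = Suc (card u)"
      have c_card: "Suc k \<le> card t" "card t \<le> n - Suc k" if "t \<in> c" for t
        using levelled_card[OF j that] by auto
      have "u \<in> insert a (insert (f z) c)" "v \<in> insert a (insert (f z) c)" using u v ext by auto
      then consider "u = a" "v \<in> c" | "u \<in> c" "v = f z" | "u \<in> c" "v \<in> c"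
        | "u = f z" | "v = a" | "u = a" "v = f z" by blast
      then show "u \<subset> v"
      proof cases
        case 1
        then have "v = x" using D_unique[OF c, of v x] x uv ca by simp
        then show ?thesis using ax 1 by simp
      next
        case 2
        then have "u = z" using D_unique[OF c, of u z] z uv ca by simp
        then show ?thesis using fz 2 by simp
      next
        case 3
        then show ?thesis using j uv by (auto simp: levelled_def)
      next
        case 4
        then have "card v > n - k" using uv ca by simp
        then show ?thesis using \<open>v \<in> insert a (insert (f z) c)\<close> c_card[of v] ca kn by auto
      next
        case 5
        then have "card u < k" using uv ca by simp
        then show ?thesis using \<open>u \<in> insert a (insert (f z) c)\<close> c_card[of u] ca kn by auto
      next
        case 6
        then show ?thesis using uv ca kn by simp
      qed
    qed
    then show ?thesis by blast
  qed
qed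

text \<open>A new lower set joins the chain of its image, a new upper set the chain of its preimage.
  Surjectivity of \<open>f\<close> places every new upper set, and injectivity prevents two chains
  from gaining the same one.\<close>

lemma band_scd_extend: "band_scd n k (extend f ` D)"
  unfolding band_scd_def
proof (intro conjI ballI)
  fix c' assume "c' \<in> extend f ` D"
  then show "\<exists>j. levelled n j c'" using levelled_extend by blast
next
  have sub: "band n (Suc k) \<subseteq> band n k" by (auto simp: band_def)
  have lv: "level n k \<subseteq> band n k" "level n (n - k) \<subseteq> band n k" using kn by (auto simp: band_def level_def)
  show "partition_on (band n k) (extend f ` D)"
  proof (rule partition_onI)
    show "\<Union> (extend f ` D) = band n k"
    proof (intro equalityI subsetI)
      fix x assume "x \<in> \<Union> (extend f ` D)"
      then show "x \<in> band n k" using sub lv D_subset unfolding extend_def by blast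
    next
      fix x assume x: "x \<in> band n k"
      then consider "x \<in> band n (Suc k)" | "x \<in> level n k" | "x \<in> level n (n - k)"
        using kn by (fastforce simp: band_def level_def)
      then show "x \<in> \<Union> (extend f ` D)"
      proof cases
        case 1
        then show ?thesis using D_ex[OF 1] by (auto simp: extend_def)
      next
        case 2
        then have "f x \<in> band n (Suc k)" using matching_lower(1) levels_in_band(1) by blast
        then obtain c where "c \<in> D" "f x \<in> c" using D_ex by blast
        then show ?thesis using 2 by (auto simp: extend_def)
      next
        case 3
        then obtain z where z: "z \<in> level n k \<union> level n (n - Suc k)" "f z = x"
          using matching_surj[of x] by blast
        have "z \<notin> level n k" using matching_lower(1)[of z] z(2) 3 levels_disjoint(2) by blast
        then have zl: "z \<in> level n (n - Suc k)" using z(1) by blast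
        then have "z \<in> band n (Suc k)" using levels_in_band(2) by blast
        then obtain c where "c \<in> D" "z \<in> c" using D_ex by blast
        then show ?thesis using 3 z zl by (auto simp: extend_def)
      qed
    qed
    show "{} \<notin> extend f ` D"
      using partition_onD3[OF D_partition] by (auto simp: extend_def)
    show "disjnt p q" if pq: "p \<in> extend f ` D" "q \<in> extend f ` D" "p \<noteq> q" for p q
    proof (rule ccontr)
      assume "\<not> disjnt p q"
      then obtain y where y: "y \<in> p" "y \<in> q" by (auto simp: disjnt_def)
      obtain c d where cd: "c \<in> D" "d \<in> D" "p = extend f c" "q = extend f d" using pq(1,2) by blast
      have cb: "c \<subseteq> band n (Suc k)" "d \<subseteq> band n (Suc k)" using D_subset cd by auto
      have "c = d"
      proof (cases "y \<in> band n (Suc k)")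
        case True
        then have "y \<in> c" "y \<in> d" using y cd extend_Int_band by blast+
        then show ?thesis using D_same cd by blast
      next
        case False
        show ?thesis
        proof (cases "y \<in> level n k")
          case True
          then have "y \<notin> level n (n - k)" using levels_disjoint(3) by blast
          then have "f y \<in> c" "f y \<in> d" using y cd(3,4) cb False unfolding extend_def by blast+
          then show ?thesis using D_same cd by blast
        next
          case no: False
          then obtain z z' where "z \<in> c \<inter> level n (n - Suc k)" "y = f z" "z' \<in> d \<inter> level n (n - Suc k)" "y = f z'"
            using y cd(3,4) cb False unfolding extend_def by blast
          moreover from this have "z = z'" using matching_inj[of z z'] by blast
          ultimately have "z = z'" "z \<in> c" "z' \<in> d" by blast+
          then show ?thesis using D_same cd by blast
        qed
      qed
      then show False using pq(3) cd by simp
    qed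
  qed
qed

end

text \<open>Intersecting with the old band shows which new part prolongs which old chain. Hence the
  new sets of each chain are known, and \<open>f\<close> is recovered from them; a top without a new
  set above it is matched to the bottom of its own chain.\<close>

lemma extend_inj:
  assumes f: "f \<in> ext_matchings" and g: "g \<in> ext_matchings" and eq: "extend f ` D = extend g ` D"
  shows "f = g"
proof -
  have ext_eq: "extend f c = extend g c" if c: "c \<in> D" for c
  proof -
    obtain c' where c': "c' \<in> D" "extend f c = extend g c'" using eq c by blast
    then have "c = c'" using extend_Int_band[OF f c] extend_Int_band[OF g c'(1)] by simp
    then show ?thesis using c' by simp
  qed
  \<comment> \<open>Stated for arbitrary \<open>f\<close> and \<open>g\<close>, as it is applied
    with the two roles exchanged as well.\<close>
  have swap: "f z = g z" if fg: "f \<in> ext_matchings" "g \<in> ext_matchings" "extend f c = extend g c"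
    and c: "c \<in> D" "z \<in> c" and z: "z \<in> level n (n - Suc k)" "f z \<in> level n (n - k)" for f g c z
  proof -
    have "f z \<in> extend g c" unfolding fg(3)[symmetric] using z c by (auto simp: extend_def)
    moreover have "f z \<notin> c" using D_subset[OF c(1)] levels_notin_band(2)[OF z(2)] by blast
    moreover have "f z \<notin> level n k" using z(2) levels_disjoint(3) by blast
    ultimately obtain z' where z': "z' \<in> c \<inter> level n (n - Suc k)" "f z = g z'"
      unfolding extend_def by blast
    then have "z' = z" using D_unique[OF c(1), of z' z] c z by (auto simp: level_def)
    then show ?thesis using z' by simp
  qed
  have "f x = g x" if x: "x \<in> level n k \<union> level n (n - Suc k)" for x
    using x
  proof
    assume x: "x \<in> level n k"
    have "f x \<in> band n (Suc k)" using matching_lower(1)[OF f x] levels_in_band(1) by blast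
    then obtain c where c: "c \<in> D" "f x \<in> c" using D_ex by blast
    then have "x \<in> extend g c" unfolding ext_eq[OF c(1), symmetric] using x by (auto simp: extend_def)
    moreover have "x \<notin> c" using D_subset[OF c(1)] levels_notin_band(1)[OF x] by blast
    moreover have "x \<notin> level n (n - k)" using x levels_disjoint(3) by blast
    ultimately have "g x \<in> c" unfolding extend_def by blast
    then show ?thesis using D_unique[OF c(1), of "f x" "g x"] c matching_lower[OF f x] matching_lower[OF g x]
      by (simp add: level_def)
  next
    assume x: "x \<in> level n (n - Suc k)"
    have "x \<in> band n (Suc k)" using x levels_in_band(2) by blast
    then obtain c where c: "c \<in> D" "x \<in> c" using D_ex by blast
    note e = ext_eq[OF c(1)]
    show ?thesis
    proof (cases "f x \<in> level n (n - k) \<or> g x \<in> level n (n - k)")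
      case True
      then show ?thesis using swap[OF f g e c x] swap[OF g f e[symmetric] c x] by auto
    next
      case False
      then have *: "f x \<in> level n (Suc k)" "same_chain x (f x)" "g x \<in> level n (Suc k)" "same_chain x (g x)"
        using matching_upper[OF f x] matching_upper[OF g x] by auto
      then have "f x \<in> c" "g x \<in> c" using D_same[OF _ c(1) _ c(2)] unfolding same_chain_def by blast+
      then show ?thesis using D_unique[OF c(1), of "f x" "g x"] * by (simp add: level_def)
    qed
  qed
  then show ?thesis using f g
    by (intro extensionalityI[of f "level n k \<union> level n (n - Suc k)" g])
       (auto simp: ext_matchings_def bijs_def PiE_def)
qed

lemma finite_ext_matchings: "finite ext_matchings"
  by (simp add: ext_matchings_def)

end

section \<open>The lower bound and the limit\<close>

text \<open>The pair of \<open>D\<close> and \<open>f\<close> is recovered from the result: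
  \<open>D\<close> by intersecting the parts with the inner band, then \<open>f\<close> by
  \<open>extend_inj\<close>. The matching bound holds uniformly in \<open>D\<close>, so the counts
  multiply.\<close>

lemma card_band_scd_step:
  assumes "2 * Suc k \<le> n"
  shows "real (card {D. band_scd n k D}) \<ge> real (card {D. band_scd n (Suc k) D}) *
     (exp (- (real (n choose k) + real (n choose Suc k))) * (real n - real k) ^ (2 * (n choose k)))"
proof -
  let ?S = "{D. band_scd n (Suc k) D}"
  let ?e = "exp (- (real (n choose k) + real (n choose Suc k))) * (real n - real k) ^ (2 * (n choose k))"
  let ?F = "\<lambda>(D, f). extend n k f ` D"
  have inj: "inj_on ?F (SIGMA D:?S. ext_matchings n k D)"
  proof (rule inj_onI, clarify)
    fix D f D' f'
    assume D: "band_scd n (Suc k) D" "f \<in> ext_matchings n k D"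
      and D': "band_scd n (Suc k) D'" "f' \<in> ext_matchings n k D'"
      and eq: "extend n k f ` D = extend n k f' ` D'"
    have "(\<lambda>c. c \<inter> band n (Suc k)) ` extend n k f ` D = D"
      unfolding image_image using extend_Int_band[OF assms D] by simp
    moreover have "(\<lambda>c. c \<inter> band n (Suc k)) ` extend n k f' ` D' = D'"
      unfolding image_image using extend_Int_band[OF assms D'] by simp
    ultimately have "D = D'" using eq by simp
    then show "D = D' \<and> f = f'" using extend_inj[OF assms D(1,2)] D'(2) eq by blast
  qed
  have "real (card ?S) * ?e = (\<Sum>D\<in>?S. ?e)" by simp
  also have "\<dots> \<le> (\<Sum>D\<in>?S. real (card (ext_matchings n k D)))"
    using card_ext_matchings_ge[OF assms] by (intro sum_mono) simp
  also have "\<dots> = real (card (SIGMA D:?S. ext_matchings n k D))"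
    by (subst card_SigmaI) (auto simp: finite_ext_matchings[OF assms])
  also have "card (SIGMA D:?S. ext_matchings n k D) \<le> card {D. band_scd n k D}"
    using inj band_scd_extend[OF assms] by (intro card_inj_on_le) auto
  finally show ?thesis by simp
qed

text \<open>The product of the step bounds for \<open>k < m\<close>, with every base
  \<open>n - k\<close> lowered to \<open>n / 2\<close>.\<close>

lemma card_band_scd_0_ge:
  assumes "2 * m \<le> n"
  shows "real (num_scd n) \<ge> real (card {D. band_scd n m D}) *
    (exp (- (\<Sum>k<m. real (n choose k) + real (n choose Suc k))) * (real n / 2) ^ (\<Sum>k<m. 2 * (n choose k)))"
  using assms
proof (induction m)
  case 0
  then show ?case by (simp add: card_band_scd_0)
next
  case (Suc m)
  let ?E = "\<lambda>m. exp (- (\<Sum>k<m. real (n choose k) + real (n choose Suc k)))"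
  let ?P = "\<lambda>m. (real n / 2) ^ (\<Sum>k<m. 2 * (n choose k))"
  let ?N = "\<lambda>m. real (card {D. band_scd n m D})"
  let ?e = "exp (- (real (n choose m) + real (n choose Suc m)))"
  have "?N (Suc m) * (?E (Suc m) * ?P (Suc m)) =
      ?N (Suc m) * (?e * (real n / 2) ^ (2 * (n choose m))) * (?E m * ?P m)"
    by (simp add: power_add mult_exp_exp[symmetric] exp_diff exp_minus field_simps exp_add)
  also have "\<dots> \<le> ?N (Suc m) * (?e * (real n - real m) ^ (2 * (n choose m))) * (?E m * ?P m)"
    using Suc.prems by (intro mult_right_mono mult_left_mono power_mono mult_nonneg_nonneg) auto
  also have "\<dots> \<le> ?N m * (?E m * ?P m)"
    using card_band_scd_step[OF Suc.prems] by (intro mult_right_mono) auto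
  also have "\<dots> \<le> real (num_scd n)" using Suc by simp
  finally show ?case .
qed

text \<open>For odd \<open>n\<close> the inclusion graph between the two middle levels is regular of
  degree \<open>n div 2 + 1\<close>. The permanent bound, used only for positivity, supplies a
  perfect matching in the role of Hall's theorem.\<close>

lemma ex_middle_matching:
  obtains f where "bij_betw f (level n (n div 2)) (level n (n - n div 2))"
    "\<And>x. x \<in> level n (n div 2) \<Longrightarrow> x \<subseteq> f x"
proof (cases "even n")
  case True
  then have "n - n div 2 = n div 2" by auto
  then show ?thesis using that[of id] by (simp add: bij_betw_def)
next
  case False
  then obtain m where m: "n = 2 * m + 1" using oddE by blast
  then have nm: "n div 2 = m" "n - n div 2 = Suc m" by auto
  let ?X = "level n m" and ?Y = "level n (Suc m)"
  let ?w = "\<lambda>x y :: nat set. if x \<subset> y then 1 / real (Suc m) else 0"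
  have count: "(\<Sum>y\<in>S. if P y then q else 0) = real (card {y \<in> S. P y}) * q" if "finite S" for S P and q :: real
    using that by (simp add: sum.If_cases Int_def)
  have "n choose m = n choose Suc m" using binomial_symmetric[of m n] m by simp
  then have "exp (- real (card ?X)) \<le> permanent ?w ?X ?Y"
    using card_up_level[of _ n m] card_down_level[of _ n m] m
    by (intro permanent_doubly_stochastic_ge) (auto simp: count)
  then have "permanent ?w ?X ?Y > 0" by (rule less_le_trans[OF exp_gt_zero])
  then obtain f where f: "f \<in> bijs ?X ?Y" "(\<Prod>x\<in>?X. ?w x (f x)) \<noteq> 0"
    unfolding permanent_def using sum.neutral[of "bijs ?X ?Y" "\<lambda>f. \<Prod>x\<in>?X. ?w x (f x)"] by fastforce
  have "x \<subseteq> f x" if "x \<in> ?X" for x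
    using f(2) that by (auto split: if_splits)
  then show ?thesis using that[of f] f(1) nm by (simp add: bijs_def)
qed

text \<open>The starting point of the descent. For odd \<open>n\<close> the parts are the matched
  pairs; for even \<open>n\<close> equal sizes force \<open>f x = x\<close> and the parts are
  singletons.\<close>

lemma ex_middle_band_scd: "\<exists>D. band_scd n (n div 2) D"
proof -
  define m where "m = n div 2"
  obtain f where f: "bij_betw f (level n m) (level n (n - m))" "\<And>x. x \<in> level n m \<Longrightarrow> x \<subseteq> f x"
    unfolding m_def using ex_middle_matching[of n] by blast
  have m: "2 * m \<le> n" "n - m \<le> Suc m" "m \<le> n - m" unfolding m_def by linarith+
  have fl: "f x \<in> level n (n - m)" if "x \<in> level n m" for x using f(1) that by (auto simp: bij_betw_def)
  have self: "f x = x" if "n - m = m" "x \<in> level n m" for x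
  proof -
    have "finite (f x)" using fl[OF that(2)] by (auto simp: level_def intro: finite_subset)
    moreover have "card x = card (f x)" using fl[OF that(2)] that by (simp add: level_def)
    ultimately show ?thesis using card_subset_eq[OF _ f(2)[OF that(2)]] by simp
  qed
  have lev: "levelled n m {x, f x}" if x: "x \<in> level n m" for x
    unfolding levelled_def
  proof (intro conjI)
    have c: "card x = m" "card (f x) = n - m" "x \<subseteq> {1..n}" "f x \<subseteq> {1..n}"
      using x fl[OF x] by (auto simp: level_def)
    show "2 * m \<le> n" by (rule m)
    show "{x, f x} \<subseteq> Pow {1..n}" using c by simp
    have "{m..n - m} = {m, n - m}" using m by auto
    moreover have "inj_on card {x, f x}"
      using c self[OF _ x] by (auto simp: inj_on_def)
    ultimately show "bij_betw card {x, f x} {m..n - m}" using c by (simp add: bij_betw_def)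
    show "\<forall>u\<in>{x, f x}. \<forall>v\<in>{x, f x}. card v = Suc (card u) \<longrightarrow> u \<subset> v"
    proof (intro ballI impI)
      fix u v assume "u \<in> {x, f x}" "v \<in> {x, f x}" "card v = Suc (card u)"
      then have "u = x" "v = f x" using c m by auto
      then show "u \<subset> v" using f(2)[OF x] \<open>card v = Suc (card u)\<close> by auto
    qed
  qed
  have "partition_on (band n m) ((\<lambda>x. {x, f x}) ` level n m)"
  proof (rule partition_onI)
    have "band n m = level n m \<union> level n (n - m)"
      using m by (auto simp: band_def level_def)
    moreover have "\<Union> ((\<lambda>x. {x, f x}) ` level n m) = level n m \<union> f ` level n m" by auto
    ultimately show "\<Union> ((\<lambda>x. {x, f x}) ` level n m) = band n m" using f(1) by (simp add: bij_betw_def)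
    fix p q assume "p \<in> (\<lambda>x. {x, f x}) ` level n m" "q \<in> (\<lambda>x. {x, f x}) ` level n m" "p \<noteq> q"
    then obtain x y where xy: "p = {x, f x}" "q = {y, f y}" "x \<in> level n m" "y \<in> level n m" "x \<noteq> y" by auto
    then have "f x \<noteq> f y" using f(1) by (auto simp: bij_betw_def inj_on_def)
    moreover have sep: "u \<noteq> f v" if uv: "u \<in> level n m" "v \<in> level n m" "u \<noteq> v" for u v
    proof
      assume "u = f v"
      then have "n - m = m" using fl[OF uv(2)] uv(1) by (simp add: level_def)
      then show False using self[OF _ uv(2)] uv(3) \<open>u = f v\<close> by simp
    qed
    have "x \<noteq> f y" "f x \<noteq> y" using sep[OF xy(3,4,5)] sep[OF xy(4,3)] xy(5) by auto
    ultimately show "disjnt p q" using xy by (auto simp: disjnt_def)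
  qed auto
  then have "band_scd n m ((\<lambda>x. {x, f x}) ` level n m)"
    unfolding band_scd_def using lev by blast
  then show ?thesis unfolding m_def by blast
qed

text \<open>The first sum is the total size of all matchings: reflecting \<open>k\<close> to
  \<open>n - k\<close> in one half and shifting in the other makes it a sum over distinct levels.
  The second bounds the exponent of \<open>n / 2\<close> from below, because the levels up to
  \<open>m\<close> and their reflections cover everything.\<close>

lemma binomial_half_sums:
  fixes n :: nat
  defines "m \<equiv> n div 2"
  shows "(\<Sum>k<m. (n choose k) + (n choose Suc k)) \<le> 2 ^ n"
    and "2 ^ n \<le> (\<Sum>k<m. 2 * (n choose k)) + 2 * (n choose m)"
proof -
  have m: "2 * m \<le> n" "n \<le> 2 * m + 1" unfolding m_def by linarith+
  have "(\<Sum>k<m. n choose k) = (\<Sum>j\<in>(\<lambda>k. n - k) ` {..<m}. n choose j)"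
    using m by (subst sum.reindex) (auto simp: inj_on_def binomial_symmetric[symmetric] intro!: sum.cong binomial_symmetric)
  moreover have "(\<Sum>k<m. n choose Suc k) = (\<Sum>j\<in>Suc ` {..<m}. n choose j)"
    by (subst sum.reindex) auto
  ultimately have "(\<Sum>k<m. (n choose k) + (n choose Suc k)) =
      (\<Sum>j\<in>(\<lambda>k. n - k) ` {..<m} \<union> Suc ` {..<m}. n choose j)"
    using m by (subst sum.union_disjoint) (auto simp: sum.distrib)
  also have "\<dots> \<le> (\<Sum>j\<le>n. n choose j)"
    using m by (intro sum_mono2) auto
  finally show "(\<Sum>k<m. (n choose k) + (n choose Suc k)) \<le> 2 ^ n" by (simp add: choose_row_sum)
  have "{..n} \<subseteq> {..m} \<union> (\<lambda>k. n - k) ` {..m}"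
  proof
    fix j assume "j \<in> {..n}"
    then have "j \<le> m \<or> j = n - (n - j) \<and> n - j \<le> m" using m by auto
    then show "j \<in> {..m} \<union> (\<lambda>k. n - k) ` {..m}" by blast
  qed
  then have "(\<Sum>j\<le>n. n choose j) \<le> (\<Sum>j\<in>{..m} \<union> (\<lambda>k. n - k) ` {..m}. n choose j)"
    by (intro sum_mono2) auto
  also have "\<dots> \<le> (\<Sum>j\<le>m. n choose j) + (\<Sum>j\<in>(\<lambda>k. n - k) ` {..m}. n choose j)"
    using sum.union_inter[of "{..m}" "(\<lambda>k. n - k) ` {..m}" "\<lambda>j. n choose j"] by simp
  also have "(\<Sum>j\<in>(\<lambda>k. n - k) ` {..m}. n choose j) = (\<Sum>k\<le>m. n choose k)"
    using m by (subst sum.reindex) (auto simp: inj_on_def intro!: sum.cong binomial_symmetric[symmetric])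
  also have "(\<Sum>k\<le>m. n choose k) = (\<Sum>k<m. n choose k) + (n choose m)"
    by (simp flip: lessThan_Suc_atMost)
  finally show "2 ^ n \<le> (\<Sum>k<m. 2 * (n choose k)) + 2 * (n choose m)"
    by (simp add: choose_row_sum sum_distrib_left[symmetric])
qed

lemma num_scd_ge:
  assumes "n \<ge> 2"
  shows "exp (2 ^ n * (ln (real n / 2) - 1) - 2 * real (n choose (n div 2)) * ln (real n / 2)) \<le> real (num_scd n)"
proof -
  define m where "m = n div 2"
  let ?a = "\<Sum>k<m. (n choose k) + (n choose Suc k)" and ?b = "\<Sum>k<m. 2 * (n choose k)"
  have l: "ln (real n / 2) \<ge> 0" using assms by simp
  have exp_ab: "exp (real b * ln (real n / 2) - real a) = exp (- real a) * (real n / 2) ^ b" for a b :: nat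
    using assms by (simp add: exp_diff exp_minus exp_of_nat_mult field_simps)
  have a: "real ?a \<le> 2 ^ n"
  proof -
    have "real ?a \<le> real (2 ^ n)" using binomial_half_sums(1)[of n] unfolding m_def by (simp only: of_nat_le_iff)
    then show ?thesis by simp
  qed
  have b: "2 ^ n - 2 * real (n choose m) \<le> real ?b"
  proof -
    have "real (2 ^ n) \<le> real (?b + 2 * (n choose m))"
      using binomial_half_sums(2)[of n] unfolding m_def by (simp only: of_nat_le_iff)
    then show ?thesis by simp
  qed
  have "finite {D. band_scd n m D}" "{D. band_scd n m D} \<noteq> {}" using ex_middle_band_scd[of n] by (auto simp: m_def)
  then have "card {D. band_scd n m D} > 0" by (simp add: card_gt_0_iff)
  then have N: "1 \<le> real (card {D. band_scd n m D})" by simp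
  have "2 ^ n * (ln (real n / 2) - 1) - 2 * real (n choose m) * ln (real n / 2) =
      (2 ^ n - 2 * real (n choose m)) * ln (real n / 2) - 2 ^ n" by (simp add: algebra_simps)
  also have "\<dots> \<le> real ?b * ln (real n / 2) - real ?a"
    using a b l by (intro diff_mono mult_right_mono) auto
  finally have "exp (2 ^ n * (ln (real n / 2) - 1) - 2 * real (n choose m) * ln (real n / 2))
      \<le> exp (real ?b * ln (real n / 2) - real ?a)" by simp
  also have "\<dots> = exp (- real ?a) * (real n / 2) ^ ?b"
    by (rule exp_ab)
  also have "\<dots> \<le> real (card {D. band_scd n m D}) * (exp (- real ?a) * (real n / 2) ^ ?b)"
    using mult_right_mono[OF N, of "exp (- real ?a) * (real n / 2) ^ ?b"] by simp
  also have "\<dots> \<le> real (num_scd n)"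
    using card_band_scd_0_ge[of m n] by (simp add: m_def)
  finally show ?thesis by (simp add: m_def)
qed

lemma num_scd_root_bounds:
  assumes "n \<ge> 6"
  shows "real n / (2 * exp 1) * exp (- 2 * ln (real n / 2) / sqrt (real n)) \<le> real (num_scd n) powr (1 / 2 ^ n)"
    and "real (num_scd n) powr (1 / 2 ^ n) \<le>
      real n / (2 * exp 1) * exp (5 * real n powr (- 1 / 4) + 2 / sqrt (real n) + 4 * (ln (real n) + 1) / real n)"
proof -
  define M where "M = real (n choose (n div 2))"
  have n: "real n \<ge> 6" using assms by simp
  have M: "M \<le> 2 ^ n / sqrt (real n)" unfolding M_def using assms by (intro middle_binomial_le) simp
  have l: "ln (real n / 2) \<ge> 0" using n by simp
  have root: "exp (2 ^ n * x) powr (1 / 2 ^ n) = exp x" for x :: real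
    by (simp add: powr_def)
  have base: "exp (ln (real n / 2) - 1 + x) = real n / (2 * exp 1) * exp x" for x
    using n by (simp add: exp_add exp_diff)
  have "2 ^ n * (ln (real n / 2) - 1 + - 2 * ln (real n / 2) / sqrt (real n)) \<le>
      2 ^ n * (ln (real n / 2) - 1) - 2 * M * ln (real n / 2)"
    using mult_right_mono[OF M l] by (simp add: algebra_simps)
  then have "exp (2 ^ n * (ln (real n / 2) - 1 + - 2 * ln (real n / 2) / sqrt (real n))) \<le>
      exp (2 ^ n * (ln (real n / 2) - 1) - 2 * M * ln (real n / 2))"
    by (rule iffD2[OF exp_le_cancel_iff])
  also have "\<dots> \<le> real (num_scd n)" unfolding M_def by (rule num_scd_ge) (use assms in simp)
  finally have "exp (2 ^ n * (ln (real n / 2) - 1 + - 2 * ln (real n / 2) / sqrt (real n))) powr (1 / 2 ^ n)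
      \<le> real (num_scd n) powr (1 / 2 ^ n)"
    by (intro powr_mono2) auto
  then show "real n / (2 * exp 1) * exp (- 2 * ln (real n / 2) / sqrt (real n)) \<le> real (num_scd n) powr (1 / 2 ^ n)"
    unfolding root base .
  \<comment> \<open>This choice balances the cost \<open>\<delta>\<close> per set against
    \<open>M / \<delta>\<close>, which is at most \<open>2 ^ n * \<delta>\<close> because
    \<open>M \<le> 2 ^ n / sqrt n\<close>. Squaring turns \<open>2 * M / \<delta>\<close> into
    \<open>4 * M / \<delta>\<close>, whence the coefficient 5 in the result.\<close>
  define \<delta> where "\<delta> = real n powr (- 1 / 4)"
  have \<delta>: "\<delta> > 0" using n by (simp add: \<delta>_def)
  have "sqrt (real n) = real n powr (1 / 2)" using n by (simp add: powr_half_sqrt)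
  then have "\<delta> * \<delta> * sqrt (real n) = 1" using n by (simp add: \<delta>_def powr_add[symmetric])
  then have sd: "1 / sqrt (real n) / \<delta> = \<delta>" using \<delta> n by (simp add: field_simps)
  \<comment> \<open>The threshold 6 on \<open>n\<close> comes from here: it ensures
    \<open>2 * exp 1 \<le> n\<close>.\<close>
  have "exp 1 \<le> (3 :: real)" by (rule exp_le)
  then have big: "2 * exp 1 \<le> real n" using n by linarith
  define Z where "Z = ln (real n / 2) - 1 + \<delta> + 4 * (ln (real n) + 1) / real n"
  define L where "L = 2 ^ n / 2 * Z + M + 2 * M / \<delta>"
  have "real (num_scd n) \<le> (real (card (sdr (up_nbrs n) (lower_half n))))\<^sup>2"
    using num_scd_le[of n] by (metis of_nat_le_iff of_nat_power)
  also have "\<dots> \<le> (exp L)\<^sup>2"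
    using card_sdr_up_nbrs_le[OF _ \<delta> big] assms unfolding L_def M_def Z_def by (intro power_mono) auto
  also have "\<dots> = exp (2 * L)" by (simp add: exp_double)
  also have "2 * L \<le> 2 ^ n * (Z + 2 / sqrt (real n) + 4 * \<delta>)"
  proof -
    have "M / \<delta> \<le> 2 ^ n * (1 / sqrt (real n) / \<delta>)"
      using divide_right_mono[OF M, of \<delta>] \<delta> by simp
    then have "M / \<delta> \<le> 2 ^ n * \<delta>" unfolding sd .
    have "2 * L = 2 ^ n * Z + 2 * M + 4 * (M / \<delta>)" by (simp add: L_def algebra_simps)
    also have "\<dots> \<le> 2 ^ n * Z + 2 * (2 ^ n / sqrt (real n)) + 4 * (2 ^ n * \<delta>)"
      using M \<open>M / \<delta> \<le> 2 ^ n * \<delta>\<close> by (intro add_mono mult_left_mono) auto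
    finally show ?thesis by (simp add: algebra_simps)
  qed
  finally have "real (num_scd n) \<le> exp (2 ^ n * (Z + 2 / sqrt (real n) + 4 * \<delta>))" by simp
  then have "real (num_scd n) powr (1 / 2 ^ n) \<le> exp (2 ^ n * (Z + 2 / sqrt (real n) + 4 * \<delta>)) powr (1 / 2 ^ n)"
    by (intro powr_mono2) auto
  also have "\<dots> = exp (ln (real n / 2) - 1 + (5 * \<delta> + 2 / sqrt (real n) + 4 * (ln (real n) + 1) / real n))"
    unfolding root Z_def by (simp add: algebra_simps)
  finally show "real (num_scd n) powr (1 / 2 ^ n) \<le>
      real n / (2 * exp 1) * exp (5 * real n powr (- 1 / 4) + 2 / sqrt (real n) + 4 * (ln (real n) + 1) / real n)"
    unfolding base \<delta>_def .
qed

theorem theorem1p1: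
  "\<exists>\<epsilon> :: nat \<Rightarrow> real. \<epsilon> \<in> o(\<lambda>n. real n) \<and>
     (\<forall>n. real (num_scd n) = (real n / (2 * exp 1) + \<epsilon> n) ^ (2 ^ n) \<and>
          real (num_scd n) powr (1 / 2 ^ n) = real n / (2 * exp 1) + \<epsilon> n)"
proof -
  define R where "R = (\<lambda>n. real (num_scd n) powr (1 / 2 ^ n))"
  \<comment> \<open>With \<open>\<epsilon>\<close> the exact error of the root, both identities hold
    for every \<open>n\<close>, and the bounds are needed only for the little-o claim.\<close>
  define \<epsilon> where "\<epsilon> = (\<lambda>n. R n - real n / (2 * exp 1))"
  have "(\<lambda>n. R n / real n) \<longlonglongrightarrow> 1 / (2 * exp 1)"
  proof (rule tendsto_sandwich)
    let ?lo = "\<lambda>n. 1 / (2 * exp 1) * exp (- 2 * ln (real n / 2) / sqrt (real n))"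
    let ?up = "\<lambda>n. 1 / (2 * exp 1) * exp (5 * real n powr (- 1 / 4) + 2 / sqrt (real n) + 4 * (ln (real n) + 1) / real n)"
    show "eventually (\<lambda>n. ?lo n \<le> R n / real n) sequentially"
      using eventually_ge_at_top[of 6]
    proof eventually_elim
      case (elim n)
      then show ?case using num_scd_root_bounds(1)[of n] by (simp add: R_def pos_le_divide_eq mult_ac)
    qed
    show "eventually (\<lambda>n. R n / real n \<le> ?up n) sequentially"
      using eventually_ge_at_top[of 6]
    proof eventually_elim
      case (elim n)
      then show ?case using num_scd_root_bounds(2)[of n] by (simp add: R_def pos_divide_le_eq mult_ac)
    qed
    have "(\<lambda>n. exp (- 2 * ln (real n / 2) / sqrt (real n))) \<longlonglongrightarrow> 1" by real_asymp
    from tendsto_mult_left[OF this, of "1 / (2 * exp 1)"] show "?lo \<longlonglongrightarrow> 1 / (2 * exp 1)" by simp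
    have "(\<lambda>n. exp (5 * real n powr (- 1 / 4) + 2 / sqrt (real n) + 4 * (ln (real n) + 1) / real n)) \<longlonglongrightarrow> 1"
      by real_asymp
    from tendsto_mult_left[OF this, of "1 / (2 * exp 1)"] show "?up \<longlonglongrightarrow> 1 / (2 * exp 1)" by simp
  qed
  then have "(\<lambda>n. R n / real n - 1 / (2 * exp 1)) \<longlonglongrightarrow> 0"
    using LIM_zero by blast
  moreover have "eventually (\<lambda>n. R n / real n - 1 / (2 * exp 1) = \<epsilon> n / real n) sequentially"
    using eventually_gt_at_top[of 0] by eventually_elim (simp add: \<epsilon>_def diff_divide_distrib)
  ultimately have "(\<lambda>n. \<epsilon> n / real n) \<longlonglongrightarrow> 0"
    by (rule Lim_transform_eventually)
  moreover have "eventually (\<lambda>n. real n \<noteq> 0) sequentially"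
    using eventually_gt_at_top[of 0] by eventually_elim simp
  ultimately have "\<epsilon> \<in> o(\<lambda>n. real n)" by (intro smalloI_tendsto)
  moreover have "real (num_scd n) = R n ^ (2 ^ n)" for n
  proof (cases "num_scd n = 0")
    case False
    then show ?thesis by (simp add: R_def powr_realpow[symmetric] powr_powr)
  qed (simp add: R_def)
  ultimately show ?thesis unfolding \<epsilon>_def R_def by (intro exI[of _ \<epsilon>]) (simp add: \<epsilon>_def R_def)
qed

end
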